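(* Let $n\ge1$, $s\in(0,1)$ with $s<n/2$, let $\Omega=(0,1)^n$ be the unit cube, let $q=2^*_s:=2n/(n-2s)$, and let $\varepsilon=\varepsilon_s(2^*_s):=\left(\lambda_1^s/(2^*_s-2)\right)^{1/(2s)}$, where $\lambda_1$ is the first nonzero eigenvalue of the Neumann Laplacian in $\Omega$. Then the constant function $\mathbf{1}$ is not a global minimizer of the functional $\mathcal{I}^{\varepsilon}_{s,2^*_s}$ on $\mathcal{H}^s(\Omega)\setminus\{0\}$.
   Context: All functions are real-valued. Let $0=\lambda_0<\lambda_1\le\lambda_2\le\dots$ be the eigenvalues of the Neumann Laplacian in $\Omega=(0,1)^n$ (repeated according to multiplicity), with eigenfunctions $\phi_0,\phi_1,\phi_2,\dots$ forming an orthonormal basis of $L_2(\Omega)$; $\phi_0$ is constant. The quadratic form of the spectral Neumann fractional Laplacian is $$\langle(-\Delta)^s_{Sp}u,u\rangle:=\sum_{j=1}^\infty \lambda_j^s\,(u,\phi_j)_{L_2(\Omega)}^2 .$$ Its domain, i.e. the set of $u\in L_2(\Omega)$ for which this sum is finite, coincides with the Sobolev--Slobodetskii space $\mathcal{H}^s(\Omega)$, which is continuously embedded in $L_{2^*_s}(\Omega)$. For $\varepsilon>0$ and $u\in\mathcal{H}^s(\Omega)$, $u\ne0$, $$\mathcal{I}^{\varepsilon}_{s,q}[u]:=\frac{\langle(-\Delta)^s_{Sp}u,u\rangle+\varepsilon^{2s}\|u\|^2_{L_2(\Omega)}}{\|u\|^2_{L_q(\Omega)}} .$$ The function $\mathbf{1}$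 is identically equal to one, and $\mathcal{I}^{\varepsilon}_{s,q}[\mathbf{1}]=\varepsilon^{2s}$. A function $v$ is a global minimizer of $\mathcal{I}^{\varepsilon}_{s,q}$ if $\mathcal{I}^{\varepsilon}_{s,q}[v]\le\mathcal{I}^{\varepsilon}_{s,q}[u]$ for all nonzero $u\in\mathcal{H}^s(\Omega)$. *)

theory Defs
  imports "HOL-Analysis.Analysis"
begin

definition unit_cube :: "(real^'n) set" where
  "unit_cube = {x. \<forall>i. 0 < x $ i \<and> x $ i < 1}"

text \<open>Elements of Lebesgue and Sobolev spaces are represented by functions on the whole space, of which
  only the values on \<open>\<Omega>\<close>, up to null sets, matter.\<close>

definition L2_fun :: "(real^'n) set \<Rightarrow> (real^'n \<Rightarrow> real) \<Rightarrow> bool" where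
  "L2_fun \<Omega> u \<longleftrightarrow>
     u \<in> borel_measurable (lebesgue_on \<Omega>) \<and> integrable (lebesgue_on \<Omega>) (\<lambda>x. (u x)\<^sup>2)"

definition L2_inner :: "(real^'n) set \<Rightarrow> (real^'n \<Rightarrow> real) \<Rightarrow> (real^'n \<Rightarrow> real) \<Rightarrow> real" where
  "L2_inner \<Omega> u v = (\<integral>x. u x * v x \<partial>(lebesgue_on \<Omega>))"

definition Lp_norm :: "(real^'n) set \<Rightarrow> real \<Rightarrow> (real^'n \<Rightarrow> real) \<Rightarrow> real" where
  "Lp_norm \<Omega> p u = (\<integral>x. \<bar>u x\<bar> powr p \<partial>(lebesgue_on \<Omega>)) powr (1 / p)"

definition nonzero_on :: "(real^'n) set \<Rightarrow> (real^'n \<Rightarrow> real) \<Rightarrow> bool" where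
  "nonzero_on \<Omega> u \<longleftrightarrow> \<not> (AE x in lebesgue_on \<Omega>. u x = 0)"

text \<open>\<open>test_function \<Omega> \<eta> G\<close>: the function \<open>\<eta>\<close> is continuously differentiable with compact support in
  \<open>\<Omega>\<close> and \<open>G\<close> is its gradient. Testing with such functions or with infinitely differentiable ones
  gives the same weak gradients (by mollification).\<close>

definition test_function :: "(real^'n) set \<Rightarrow> (real^'n \<Rightarrow> real) \<Rightarrow> (real^'n \<Rightarrow> real^'n) \<Rightarrow> bool" where
  "test_function \<Omega> \<eta> G \<longleftrightarrow>
     (\<forall>x. GDERIV \<eta> x :> G x) \<and> continuous_on UNIV G \<and>
     compact (closure {x. \<eta> x \<noteq> 0}) \<and> closure {x. \<eta> x \<noteq> 0} \<subseteq> \<Omega>"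

text \<open>\<open>H1_gradient \<Omega> u g\<close>: the function \<open>u\<close> belongs to the Sobolev space \<open>H\<^sup>1(\<Omega>)\<close> and \<open>g\<close> is its weak
  gradient.\<close>

definition H1_gradient :: "(real^'n) set \<Rightarrow> (real^'n \<Rightarrow> real) \<Rightarrow> (real^'n \<Rightarrow> real^'n) \<Rightarrow> bool" where
  "H1_gradient \<Omega> u g \<longleftrightarrow>
     L2_fun \<Omega> u \<and> (\<forall>i. L2_fun \<Omega> (\<lambda>x. g x $ i)) \<and>
     (\<forall>\<eta> G. test_function \<Omega> \<eta> G \<longrightarrow>
        (\<forall>i. L2_inner \<Omega> u (\<lambda>x. G x $ i) = - L2_inner \<Omega> (\<lambda>x. g x $ i) \<eta>))"

text \<open>The Neumann Laplacian is the operator generated by the Dirichlet form on all of \<open>H\<^sup>1(\<Omega>)\<close>; the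
  boundary condition is the natural one and so is encoded in the class of admissible \<open>v\<close>.\<close>

definition neumann_eigenfunction :: "(real^'n) set \<Rightarrow> real \<Rightarrow> (real^'n \<Rightarrow> real) \<Rightarrow> bool" where
  "neumann_eigenfunction \<Omega> \<mu> f \<longleftrightarrow>
     nonzero_on \<Omega> f \<and>
     (\<exists>g. H1_gradient \<Omega> f g \<and>
        (\<forall>v h. H1_gradient \<Omega> v h \<longrightarrow>
           (\<integral>x. g x \<bullet> h x \<partial>(lebesgue_on \<Omega>)) = \<mu> * L2_inner \<Omega> f v))"

definition L2_orthonormal_basis :: "(real^'n) set \<Rightarrow> (nat \<Rightarrow> real^'n \<Rightarrow> real) \<Rightarrow> bool" where
  "L2_orthonormal_basis \<Omega> \<phi> \<longleftrightarrow>
     (\<forall>j. L2_fun \<Omega> (\<phi> j)) \<and>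
     (\<forall>i j. L2_inner \<Omega> (\<phi> i) (\<phi> j) = (if i = j then 1 else 0)) \<and>
     (\<forall>u. L2_fun \<Omega> u \<longrightarrow>
        (\<lambda>N. Lp_norm \<Omega> 2 (\<lambda>x. u x - (\<Sum>j<N. L2_inner \<Omega> u (\<phi> j) * \<phi> j x))) \<longlonglongrightarrow> 0)"

text \<open>Since the eigenfunctions form a basis, \<open>ev\<close> lists every eigenvalue, with its multiplicity.\<close>

definition neumann_eigensystem ::
    "(real^'n) set \<Rightarrow> (nat \<Rightarrow> real) \<Rightarrow> (nat \<Rightarrow> real^'n \<Rightarrow> real) \<Rightarrow> bool" where
  "neumann_eigensystem \<Omega> ev \<phi> \<longleftrightarrow>
     ev 0 = 0 \<and> 0 < ev 1 \<and> mono ev \<and>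
     (\<forall>j. neumann_eigenfunction \<Omega> (ev j) (\<phi> j)) \<and>
     L2_orthonormal_basis \<Omega> \<phi>"

text \<open>The Sobolev--Slobodetskii space, by finiteness of the Gagliardo seminorm.\<close>

definition slobodetskii_space :: "(real^'n) set \<Rightarrow> real \<Rightarrow> (real^'n \<Rightarrow> real) set" where
  "slobodetskii_space \<Omega> s =
     {u. L2_fun \<Omega> u \<and>
         (\<integral>\<^sup>+x. (\<integral>\<^sup>+y. ennreal ((u x - u y)\<^sup>2 / norm (x - y) powr (real CARD('n) + 2 * s))
            \<partial>(lebesgue_on \<Omega>)) \<partial>(lebesgue_on \<Omega>)) < \<infinity>}"

definition spectral_form ::
    "(real^'n) set \<Rightarrow> (nat \<Rightarrow> real) \<Rightarrow> (nat \<Rightarrow> real^'n \<Rightarrow> real) \<Rightarrow> real \<Rightarrow> (real^'n \<Rightarrow> real) \<Rightarrow> real" where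
  "spectral_form \<Omega> ev \<phi> s u = (\<Sum>j. ev (Suc j) powr s * (L2_inner \<Omega> u (\<phi> (Suc j)))\<^sup>2)"

text \<open>On the unit cube, for \<open>u\<close> in the Sobolev--Slobodetskii space and \<open>q\<close> up to the critical exponent,
  the series and the norms below are finite, so the totalized sum, integral and division only take
  their genuine values when \<open>u\<close> is not zero.\<close>

definition energy_quotient ::
    "(real^'n) set \<Rightarrow> (nat \<Rightarrow> real) \<Rightarrow> (nat \<Rightarrow> real^'n \<Rightarrow> real) \<Rightarrow> real \<Rightarrow> real \<Rightarrow> real \<Rightarrow>
      (real^'n \<Rightarrow> real) \<Rightarrow> real" where
  "energy_quotient \<Omega> ev \<phi> s q \<epsilon> u =
     (spectral_form \<Omega> ev \<phi> s u + \<epsilon> powr (2 * s) * (Lp_norm \<Omega> 2 u)\<^sup>2) / (Lp_norm \<Omega> q u)\<^sup>2"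

definition global_minimizer ::
    "(real^'n) set \<Rightarrow> (nat \<Rightarrow> real) \<Rightarrow> (nat \<Rightarrow> real^'n \<Rightarrow> real) \<Rightarrow> real \<Rightarrow> real \<Rightarrow> real \<Rightarrow>
      (real^'n \<Rightarrow> real) \<Rightarrow> bool" where
  "global_minimizer \<Omega> ev \<phi> s q \<epsilon> v \<longleftrightarrow>
     (\<forall>u \<in> slobodetskii_space \<Omega> s. nonzero_on \<Omega> u \<longrightarrow>
        energy_quotient \<Omega> ev \<phi> s q \<epsilon> v \<le> energy_quotient \<Omega> ev \<phi> s q \<epsilon> u)"

definition critical_exponent :: "nat \<Rightarrow> real \<Rightarrow> real" where
  "critical_exponent n s = 2 * real n / (real n - 2 * s)"

definition threshold_eps :: "(nat \<Rightarrow> real) \<Rightarrow> real \<Rightarrow> real \<Rightarrow> real" where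
  "threshold_eps ev s q = (ev 1 powr s / (q - 2)) powr (1 / (2 * s))"

end

theory Submission
  imports Defs "HOL-Real_Asymp.Real_Asymp"
begin

text \<open>Here \<open>\<lambda>\<^sub>1 = \<pi>\<^sup>2\<close> with eigenfunctions \<open>cos (\<pi> x\<^sub>i)\<close>. At the threshold the second variation of the quotient
  at the constant function vanishes in these directions, and by orthogonality so does the third. The
  test family is \<open>u\<^sub>t = 1 + t S + t\<^sup>2 (b D + a P)\<close>, where \<open>S\<close> is the sum of all \<open>cos (\<pi> x\<^sub>i)\<close>,
  \<open>D\<close> the sum of all \<open>cos (2 \<pi> x\<^sub>i)\<close> and \<open>P\<close> the sum of \<open>cos (\<pi> x\<^sub>i) cos (\<pi> x\<^sub>j)\<close> over \<open>i \<noteq> j\<close>; these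
  are eigenfunctions with eigenvalues \<open>\<pi>\<^sup>2\<close>, \<open>4 \<pi>\<^sup>2\<close>, \<open>2 \<pi>\<^sup>2\<close>, and \<open>S\<^sup>2 = n / 2 + D / 2 + P\<close>. For the
  critical exponent and suitable \<open>a\<close>, \<open>b\<close> the coefficient of \<open>t\<^sup>4\<close> is negative. All coordinates have to be
  perturbed at once: a single \<open>cos (\<pi> x\<^sub>1)\<close> does not suffice when \<open>n \<ge> 2\<close> and \<open>s\<close> is close to 1.\<close>

section \<open>Inner products and spectral sums\<close>

text \<open>In a direction from an eigenspace with eigenvalue \<lambda>, the second variation at the
  constant is a positive multiple of \<lambda>^s - (q - 2) \<epsilon>^(2s). The threshold is the
  value where this vanishes for the first eigenvalue; on all higher eigenspaces it stays positive.
  So order four decides, and there a correction of size t^2 counts: its cost is quadratic in a, b,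
  and its gain is linear, given by the scalar product of S^2 with the correction. Only the
  components of S^2 can produce a gain, which singles out D and P. The system \<open>ev\<close>,
  \<open>\<phi>\<close> is arbitrary, so it has to be related to the cosines by weak formulations
  alone. The obstacle is that weak gradients are tested with compactly supported functions, while
  the derivatives of a cosine product vanish on two opposite faces only; hence the cutoff argument.
  Completeness of the cosines serves to exclude an eigenvalue strictly between 0 and
  \<pi>^2.\<close>

lemma unit_cube_eq_box: "unit_cube = box 0 (1::real^'n)"
  by (auto simp: unit_cube_def mem_box_cart)

lemma unit_cube_measurable [measurable, simp]: "unit_cube \<in> sets lebesgue"
  by (simp add: unit_cube_eq_box)

lemma measure_unit_cube: "measure lebesgue (unit_cube :: (real^'n) set) = 1"
proof -
  have "(1::real^'n) \<bullet> b = 1" if "b \<in> Basis" for b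
    using that by (auto simp: Basis_vec_def inner_axis)
  then show ?thesis by (simp add: unit_cube_eq_box)
qed

lemma emeasure_unit_cube: "emeasure lebesgue (unit_cube :: (real^'n) set) = 1"
proof -
  have "emeasure lebesgue (unit_cube :: (real^'n) set) \<noteq> \<infinity>"
    using measure_unit_cube[where 'n='n] by (auto simp: measure_def)
  then show ?thesis
    by (simp add: emeasure_eq_ennreal_measure measure_unit_cube)
qed

lemma finite_measure_cube: "finite_measure (lebesgue_on (unit_cube :: (real^'n) set))"
  by (rule finite_measureI) (simp add: emeasure_restrict_space space_restrict_space emeasure_unit_cube)

lemma cube_measurable_continuous:
  fixes f :: "real^'n \<Rightarrow> real"
  assumes "continuous_on UNIV f"
  shows "f \<in> borel_measurable (lebesgue_on unit_cube)"
  by (intro continuous_imp_measurable_on_sets_lebesgue continuous_on_subset[OF assms]) auto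

lemma cube_bounded_continuous:
  fixes f :: "real^'n \<Rightarrow> real"
  assumes "continuous_on UNIV f"
  obtains B where "B > 0" "\<And>x. x \<in> cbox 0 1 \<Longrightarrow> \<bar>f x\<bar> \<le> B"
proof -
  have "bounded (f ` cbox 0 1)"
    by (intro compact_imp_bounded compact_continuous_image continuous_on_subset[OF assms]) auto
  then show ?thesis using that by (auto simp: bounded_pos)
qed

lemma cube_integrable_bounded:
  fixes f :: "real^'n \<Rightarrow> real"
  assumes "f \<in> borel_measurable (lebesgue_on unit_cube)" "\<And>x. x \<in> unit_cube \<Longrightarrow> \<bar>f x\<bar> \<le> B"
  shows "integrable (lebesgue_on unit_cube) f"
  using assms by (intro finite_measure.integrable_const_bound[OF finite_measure_cube, where B=B])
    (auto simp: AE_restrict_space_iff)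

lemma cube_integrable_continuous:
  fixes f :: "real^'n \<Rightarrow> real"
  assumes "continuous_on UNIV f"
  shows "integrable (lebesgue_on unit_cube) f"
proof -
  obtain B where "\<And>x. x \<in> cbox 0 1 \<Longrightarrow> \<bar>f x\<bar> \<le> B" using cube_bounded_continuous[OF assms] by blast
  then show ?thesis
    by (intro cube_integrable_bounded[of _ B] cube_measurable_continuous assms)
       (use box_subset_cbox[of 0 "1::real^'n"] in \<open>auto simp: unit_cube_eq_box subset_eq\<close>)
qed

lemma L2_fun_continuous:
  fixes f :: "real^'n \<Rightarrow> real"
  assumes "continuous_on UNIV f"
  shows "L2_fun unit_cube f"
  unfolding L2_fun_def
  by (intro conjI cube_measurable_continuous cube_integrable_continuous continuous_intros assms)

lemma L2_fun_integrable_mult: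
  assumes "L2_fun \<Omega> u" "L2_fun \<Omega> v"
  shows "integrable (lebesgue_on \<Omega>) (\<lambda>x. u x * v x)"
proof (rule Bochner_Integration.integrable_bound)
  show "integrable (lebesgue_on \<Omega>) (\<lambda>x. (u x)\<^sup>2 + (v x)\<^sup>2)"
    using assms by (auto simp: L2_fun_def)
  show "(\<lambda>x. u x * v x) \<in> borel_measurable (lebesgue_on \<Omega>)"
    using assms by (auto simp: L2_fun_def)
  have "\<bar>a * b\<bar> \<le> a\<^sup>2 + b\<^sup>2" for a b :: real
  proof -
    have "2 * \<bar>a\<bar> * \<bar>b\<bar> \<le> a\<^sup>2 + b\<^sup>2" "0 \<le> \<bar>a\<bar> * \<bar>b\<bar>"
      using sum_squares_bound[of "\<bar>a\<bar>" "\<bar>b\<bar>"] by auto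
    then show ?thesis unfolding abs_mult by linarith
  qed
  then show "AE x in lebesgue_on \<Omega>. norm (u x * v x) \<le> norm ((u x)\<^sup>2 + (v x)\<^sup>2)"
    by (auto intro!: AE_I2)
qed

lemma L2_fun_scale: "L2_fun \<Omega> u \<Longrightarrow> L2_fun \<Omega> (\<lambda>x. c * u x)"
  by (auto simp: L2_fun_def power_mult_distrib)

lemma L2_fun_add:
  assumes "L2_fun \<Omega> u" "L2_fun \<Omega> v"
  shows "L2_fun \<Omega> (\<lambda>x. u x + v x)"
proof -
  have "integrable (lebesgue_on \<Omega>) (\<lambda>x. (u x)\<^sup>2 + (v x)\<^sup>2 + 2 * (u x * v x))"
    using assms L2_fun_integrable_mult[OF assms] by (auto simp: L2_fun_def)
  then show ?thesis using assms by (auto simp: L2_fun_def power2_sum mult.assoc)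
qed

lemma L2_fun_diff:
  assumes "L2_fun \<Omega> u" "L2_fun \<Omega> v"
  shows "L2_fun \<Omega> (\<lambda>x. u x - v x)"
  using L2_fun_add[OF assms(1) L2_fun_scale[OF assms(2), of "-1"]] by simp

lemma L2_fun_zero: "L2_fun \<Omega> (\<lambda>x. 0)"
  by (simp add: L2_fun_def)

lemma L2_fun_sum:
  assumes "\<And>i. i \<in> I \<Longrightarrow> L2_fun \<Omega> (u i)"
  shows "L2_fun \<Omega> (\<lambda>x. \<Sum>i\<in>I. u i x)"
  using assms by (induction I rule: infinite_finite_induct) (auto simp: L2_fun_zero intro!: L2_fun_add)

lemma L2_inner_commute: "L2_inner \<Omega> u v = L2_inner \<Omega> v u"
  by (simp add: L2_inner_def mult.commute)

lemma L2_inner_scale_left: "L2_inner \<Omega> (\<lambda>x. c * u x) v = c * L2_inner \<Omega> u v"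
  by (simp add: L2_inner_def mult.assoc)

lemma L2_inner_scale_right: "L2_inner \<Omega> v (\<lambda>x. c * u x) = c * L2_inner \<Omega> v u"
  by (simp add: L2_inner_def mult.left_commute)

lemma L2_inner_add_left:
  assumes "L2_fun \<Omega> u" "L2_fun \<Omega> v" "L2_fun \<Omega> w"
  shows "L2_inner \<Omega> (\<lambda>x. u x + v x) w = L2_inner \<Omega> u w + L2_inner \<Omega> v w"
  using assms by (simp add: L2_inner_def distrib_right L2_fun_integrable_mult)

lemma L2_inner_diff_left:
  assumes "L2_fun \<Omega> u" "L2_fun \<Omega> v" "L2_fun \<Omega> w"
  shows "L2_inner \<Omega> (\<lambda>x. u x - v x) w = L2_inner \<Omega> u w - L2_inner \<Omega> v w"
  using assms by (simp add: L2_inner_def left_diff_distrib L2_fun_integrable_mult)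

lemma L2_inner_sum_left:
  assumes "\<And>i. i \<in> I \<Longrightarrow> L2_fun \<Omega> (u i)" "L2_fun \<Omega> w"
  shows "L2_inner \<Omega> (\<lambda>x. \<Sum>i\<in>I. u i x) w = (\<Sum>i\<in>I. L2_inner \<Omega> (u i) w)"
  using assms by (simp add: L2_inner_def sum_distrib_right L2_fun_integrable_mult)

lemma L2_inner_add_right:
  assumes "L2_fun \<Omega> u" "L2_fun \<Omega> v" "L2_fun \<Omega> w"
  shows "L2_inner \<Omega> w (\<lambda>x. u x + v x) = L2_inner \<Omega> w u + L2_inner \<Omega> w v"
  using L2_inner_add_left[OF assms] by (simp only: L2_inner_commute)

lemma L2_inner_diff_right:
  assumes "L2_fun \<Omega> u" "L2_fun \<Omega> v" "L2_fun \<Omega> w"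
  shows "L2_inner \<Omega> w (\<lambda>x. u x - v x) = L2_inner \<Omega> w u - L2_inner \<Omega> w v"
  using L2_inner_diff_left[OF assms] by (simp only: L2_inner_commute)

lemma L2_inner_sum_right:
  assumes "\<And>i. i \<in> I \<Longrightarrow> L2_fun \<Omega> (u i)" "L2_fun \<Omega> w"
  shows "L2_inner \<Omega> w (\<lambda>x. \<Sum>i\<in>I. u i x) = (\<Sum>i\<in>I. L2_inner \<Omega> w (u i))"
  using L2_inner_sum_left[OF assms] by (simp only: L2_inner_commute)

lemma Lp_norm_2_square: "(Lp_norm \<Omega> 2 u)\<^sup>2 = L2_inner \<Omega> u u"
  unfolding Lp_norm_def L2_inner_def
  by (simp add: powr_half_sqrt integral_nonneg_AE power2_eq_square[symmetric])

text \<open>Parseval's identity. By orthonormality the squared norm of the remainder is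
  \<open>L2_inner \<Omega> u u\<close> minus the partial sum of the squared coefficients, and the
  definition of a basis says that this remainder tends to zero.\<close>

lemma L2_basis_sums:
  assumes basis: "L2_orthonormal_basis \<Omega> \<phi>" and u: "L2_fun \<Omega> u"
  shows "(\<lambda>j. (L2_inner \<Omega> u (\<phi> j))\<^sup>2) sums L2_inner \<Omega> u u"
proof -
  define c where "c j = L2_inner \<Omega> u (\<phi> j)" for j
  define p where "p N = (\<lambda>x. \<Sum>j<N. c j * \<phi> j x)" for N :: nat
  have \<phi>: "L2_fun \<Omega> (\<phi> j)" and on: "L2_inner \<Omega> (\<phi> i) (\<phi> j) = (if i = j then 1 else 0)" for i j
    using basis by (auto simp: L2_orthonormal_basis_def)
  have p: "L2_fun \<Omega> (p N)" for N
    unfolding p_def by (intro L2_fun_sum L2_fun_scale \<phi>)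
  have pw: "L2_inner \<Omega> (p N) w = (\<Sum>j<N. c j * L2_inner \<Omega> (\<phi> j) w)" if "L2_fun \<Omega> w" for N w
    unfolding p_def by (subst L2_inner_sum_left) (auto simp: L2_inner_scale_left that intro!: L2_fun_scale \<phi>)
  have pu: "L2_inner \<Omega> (p N) u = (\<Sum>j<N. (c j)\<^sup>2)" for N
    by (simp add: pw u L2_inner_commute[of \<Omega> "\<phi> _" u] c_def[symmetric] power2_eq_square)
  have p\<phi>: "L2_inner \<Omega> (\<phi> j) (p N) = c j" if "j < N" for j N
    by (subst L2_inner_commute) (simp add: pw \<phi> on that if_distrib cong: if_cong)
  have pp: "L2_inner \<Omega> (p N) (p N) = (\<Sum>j<N. (c j)\<^sup>2)" for N
    by (subst pw) (auto simp: p p\<phi> power2_eq_square intro!: sum.cong)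
  have eq: "(Lp_norm \<Omega> 2 (\<lambda>x. u x - p N x))\<^sup>2 = L2_inner \<Omega> u u - (\<Sum>j<N. (c j)\<^sup>2)" for N
  proof -
    have "(Lp_norm \<Omega> 2 (\<lambda>x. u x - p N x))\<^sup>2 = L2_inner \<Omega> (\<lambda>x. u x - p N x) (\<lambda>x. u x - p N x)"
      by (rule Lp_norm_2_square)
    also have "\<dots> = L2_inner \<Omega> u u - 2 * L2_inner \<Omega> (p N) u + L2_inner \<Omega> (p N) (p N)"
      by (simp add: L2_inner_diff_left L2_inner_diff_right u p L2_fun_diff L2_inner_commute[of \<Omega> u "p N"])
    finally show ?thesis by (simp add: pu pp)
  qed
  have "(\<lambda>N. Lp_norm \<Omega> 2 (\<lambda>x. u x - p N x)) \<longlonglongrightarrow> 0"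
    using basis u by (auto simp: L2_orthonormal_basis_def p_def c_def)
  then have "(\<lambda>N. (Lp_norm \<Omega> 2 (\<lambda>x. u x - p N x))\<^sup>2) \<longlonglongrightarrow> 0"
    by (rule tendsto_eq_intros) auto
  then have "(\<lambda>N. L2_inner \<Omega> u u - (L2_inner \<Omega> u u - (\<Sum>j<N. (c j)\<^sup>2))) \<longlonglongrightarrow> L2_inner \<Omega> u u - 0"
    unfolding eq by (intro tendsto_intros)
  then show ?thesis by (simp add: sums_def c_def)
qed

text \<open>Membership is expressed by coefficients in the given basis, so an explicit function can
  be placed in an eigenspace without knowing the multiplicity of \<open>\<mu>\<close> or any
  \<open>\<phi> j\<close>. The zero function belongs to it for every \<open>\<mu>\<close>.\<close>

definition in_eigenspace ::
  "(real^'n) set \<Rightarrow> (nat \<Rightarrow> real) \<Rightarrow> (nat \<Rightarrow> real^'n \<Rightarrow> real) \<Rightarrow> real \<Rightarrow> (real^'n \<Rightarrow> real) \<Rightarrow> bool" where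
  "in_eigenspace \<Omega> ev \<phi> \<mu> f \<longleftrightarrow> L2_fun \<Omega> f \<and> (\<forall>j. ev j \<noteq> \<mu> \<longrightarrow> L2_inner \<Omega> f (\<phi> j) = 0)"

lemma in_eigenspace_scale: "in_eigenspace \<Omega> ev \<phi> \<mu> f \<Longrightarrow> in_eigenspace \<Omega> ev \<phi> \<mu> (\<lambda>x. c * f x)"
  by (auto simp: in_eigenspace_def L2_inner_scale_left L2_fun_scale)

lemma in_eigenspace_sum:
  assumes "L2_orthonormal_basis \<Omega> \<phi>" "\<And>i. i \<in> I \<Longrightarrow> in_eigenspace \<Omega> ev \<phi> \<mu> (f i)"
  shows "in_eigenspace \<Omega> ev \<phi> \<mu> (\<lambda>x. \<Sum>i\<in>I. f i x)"
proof -
  have "L2_fun \<Omega> (\<phi> j)" for j using assms(1) by (auto simp: L2_orthonormal_basis_def)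
  then show ?thesis
    using assms(2) unfolding in_eigenspace_def by (auto simp: L2_inner_sum_left intro!: L2_fun_sum sum.neutral)
qed

text \<open>At every index at least one of the two coefficients vanishes, so the squared
  coefficients of \<open>f + g\<close> are the sums of the squares. Parseval then gives the
  Pythagorean identity for the norms, which forces the mixed term to vanish.\<close>

lemma in_eigenspace_orthogonal:
  assumes "L2_orthonormal_basis \<Omega> \<phi>" "in_eigenspace \<Omega> ev \<phi> \<mu> f" "in_eigenspace \<Omega> ev \<phi> \<nu> g" "\<mu> \<noteq> \<nu>"
  shows "L2_inner \<Omega> f g = 0"
proof -
  have \<phi>: "L2_fun \<Omega> (\<phi> j)" for j using assms(1) by (auto simp: L2_orthonormal_basis_def)
  have fg: "L2_fun \<Omega> f" "L2_fun \<Omega> g" using assms by (auto simp: in_eigenspace_def)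
  have z: "L2_inner \<Omega> f (\<phi> j) = 0 \<or> L2_inner \<Omega> g (\<phi> j) = 0" for j
    using assms by (auto simp: in_eigenspace_def)
  have "(\<lambda>j. (L2_inner \<Omega> (\<lambda>x. f x + g x) (\<phi> j))\<^sup>2) sums L2_inner \<Omega> (\<lambda>x. f x + g x) (\<lambda>x. f x + g x)"
    by (intro L2_basis_sums assms L2_fun_add fg)
  moreover have "(L2_inner \<Omega> (\<lambda>x. f x + g x) (\<phi> j))\<^sup>2 = (L2_inner \<Omega> f (\<phi> j))\<^sup>2 + (L2_inner \<Omega> g (\<phi> j))\<^sup>2" for j
    using z[of j] by (auto simp: L2_inner_add_left fg \<phi>)
  ultimately have "L2_inner \<Omega> (\<lambda>x. f x + g x) (\<lambda>x. f x + g x) = L2_inner \<Omega> f f + L2_inner \<Omega> g g"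
    using sums_add[OF L2_basis_sums[OF assms(1) fg(1)] L2_basis_sums[OF assms(1) fg(2)]] sums_unique2 by auto
  moreover have "L2_inner \<Omega> (\<lambda>x. f x + g x) (\<lambda>x. f x + g x) = L2_inner \<Omega> f f + 2 * L2_inner \<Omega> f g + L2_inner \<Omega> g g"
    by (simp add: L2_inner_add_left L2_inner_add_right fg L2_fun_add L2_inner_commute[of \<Omega> g f])
  ultimately show ?thesis by simp
qed

text \<open>Since \<open>\<mu>\<close> is injective, each \<open>\<phi> j\<close> meets at most one
  summand. Hence squaring produces no mixed terms, the weight \<open>ev j powr s\<close> may be
  replaced by \<open>\<mu> i powr s\<close>, and Parseval sums each component separately.\<close>

lemma spectral_form_sum_eigenspaces:
  assumes basis: "L2_orthonormal_basis \<Omega> \<phi>" and "ev 0 = 0" "finite I" "inj_on \<mu> I"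
    and f: "\<And>i. i \<in> I \<Longrightarrow> in_eigenspace \<Omega> ev \<phi> (\<mu> i) (f i)"
  shows "spectral_form \<Omega> ev \<phi> s (\<lambda>x. \<Sum>i\<in>I. f i x) = (\<Sum>i\<in>I. \<mu> i powr s * L2_inner \<Omega> (f i) (f i))"
proof -
  have \<phi>: "L2_fun \<Omega> (\<phi> j)" for j using basis by (auto simp: L2_orthonormal_basis_def)
  have L2: "L2_fun \<Omega> (f i)" if "i \<in> I" for i using f[OF that] by (simp add: in_eigenspace_def)
  have eq: "ev j powr s * (L2_inner \<Omega> (\<lambda>x. \<Sum>i\<in>I. f i x) (\<phi> j))\<^sup>2
      = (\<Sum>i\<in>I. \<mu> i powr s * (L2_inner \<Omega> (f i) (\<phi> j))\<^sup>2)" for j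
  proof -
    have z: "L2_inner \<Omega> (f i) (\<phi> j) = 0" if "i \<in> I" "\<mu> i \<noteq> ev j" for i
      using f[OF that(1)] that by (auto simp: in_eigenspace_def)
    have inner: "L2_inner \<Omega> (\<lambda>x. \<Sum>i\<in>I. f i x) (\<phi> j) = (\<Sum>i\<in>I. L2_inner \<Omega> (f i) (\<phi> j))"
      by (intro L2_inner_sum_left L2 \<phi>)
    show ?thesis
    proof (cases "\<exists>k\<in>I. \<mu> k = ev j")
      case True
      then obtain k where k: "k \<in> I" "\<mu> k = ev j" by blast
      have z': "L2_inner \<Omega> (f i) (\<phi> j) = 0" if "i \<in> I - {k}" for i
        using z that k \<open>inj_on \<mu> I\<close> by (metis DiffE inj_onD singletonI)
      show ?thesis
        using k \<open>finite I\<close> unfolding inner by (simp add: sum.remove[of I k] z')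
    next
      case False
      then show ?thesis using z unfolding inner by auto
    qed
  qed
  have "(\<lambda>j. \<Sum>i\<in>I. \<mu> i powr s * (L2_inner \<Omega> (f i) (\<phi> j))\<^sup>2) sums (\<Sum>i\<in>I. \<mu> i powr s * L2_inner \<Omega> (f i) (f i))"
    by (intro sums_sum sums_mult L2_basis_sums basis L2)
  then have "(\<lambda>j. ev j powr s * (L2_inner \<Omega> (\<lambda>x. \<Sum>i\<in>I. f i x) (\<phi> j))\<^sup>2)
      sums (\<Sum>i\<in>I. \<mu> i powr s * L2_inner \<Omega> (f i) (f i))"
    by (simp add: eq)
  \<comment> \<open>The spectral form starts at index 1; the term at index 0 is zero because
    \<open>0 powr s = 0\<close>.\<close>
  then have "(\<lambda>j. ev (Suc j) powr s * (L2_inner \<Omega> (\<lambda>x. \<Sum>i\<in>I. f i x) (\<phi> (Suc j)))\<^sup>2)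
      sums (\<Sum>i\<in>I. \<mu> i powr s * L2_inner \<Omega> (f i) (f i))"
    by (subst sums_Suc_iff) (simp add: \<open>ev 0 = 0\<close>)
  then show ?thesis unfolding spectral_form_def by (rule sums_unique[symmetric])
qed

section \<open>Weak gradients and a cutoff near the boundary\<close>

lemma has_real_derivative_max0_square:
  "((\<lambda>z::real. (max 0 z)\<^sup>2) has_real_derivative 2 * max 0 z) (at z)"
proof -
  consider "z > 0" | "z < 0" | "z = 0" by linarith
  then show ?thesis
  proof cases
    case 1
    have "((\<lambda>z::real. z\<^sup>2) has_real_derivative 2 * z) (at z)"
      by (auto intro!: derivative_eq_intros)
    then have "((\<lambda>z::real. (max 0 z)\<^sup>2) has_real_derivative 2 * z) (at z)"
      by (rule has_field_derivative_transform_within_open[of _ _ _ "{0<..}"]) (use 1 in auto)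
    then show ?thesis using 1 by simp
  next
    case 2
    have "((\<lambda>z::real. 0) has_real_derivative 0) (at z)" by simp
    then have "((\<lambda>z::real. (max 0 z)\<^sup>2) has_real_derivative 0) (at z)"
      by (rule has_field_derivative_transform_within_open[of _ _ _ "{..<0}"]) (use 2 in auto)
    then show ?thesis using 2 by simp
  next
    case 3
    have "((\<lambda>y::real. ((max 0 y)\<^sup>2 - (max 0 0)\<^sup>2) / (y - 0)) \<longlongrightarrow> 0) (at 0)"
    proof (rule Lim_null_comparison)
      show "((\<lambda>y::real. \<bar>y\<bar>) \<longlongrightarrow> 0) (at 0)" by (rule tendsto_rabs_zero) (rule tendsto_ident_at)
      show "\<forall>\<^sub>F y::real in at 0. norm (((max 0 y)\<^sup>2 - (max 0 0)\<^sup>2) / (y - 0)) \<le> \<bar>y\<bar>"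
        by (intro always_eventually allI) (auto simp: max_def power2_eq_square)
    qed
    then show ?thesis using 3 by (simp add: has_field_derivative_iff)
  qed
qed

text \<open>Squaring the positive part makes the cutoff continuously differentiable; what matters later is that
  its derivative is \<open>O(1 / y)\<close> uniformly in \<open>\<delta>\<close>.\<close>

definition cutoff :: "real \<Rightarrow> real \<Rightarrow> real" where
  "cutoff \<delta> y = (max 0 (y - \<delta>))\<^sup>2 / (y\<^sup>2 + \<delta>\<^sup>2)"

definition cutoff_deriv :: "real \<Rightarrow> real \<Rightarrow> real" where
  "cutoff_deriv \<delta> y = (2 * max 0 (y - \<delta>) * (y\<^sup>2 + \<delta>\<^sup>2) - (max 0 (y - \<delta>))\<^sup>2 * (2 * y)) / (y\<^sup>2 + \<delta>\<^sup>2)\<^sup>2"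

lemma cutoff_has_derivative:
  assumes "\<delta> > 0"
  shows "(cutoff \<delta> has_real_derivative cutoff_deriv \<delta> y) (at y)"
proof -
  have "((\<lambda>y. (max 0 (y - \<delta>))\<^sup>2) has_real_derivative (2 * max 0 (y - \<delta>)) * 1) (at y)"
    by (rule DERIV_chain2[OF has_real_derivative_max0_square]) (auto intro!: derivative_eq_intros)
  moreover have "y\<^sup>2 + \<delta>\<^sup>2 \<noteq> 0"
    using assms by (simp add: sum_power2_eq_zero_iff)
  ultimately show ?thesis
    unfolding cutoff_def[abs_def] cutoff_deriv_def power2_eq_square[of "y\<^sup>2 + \<delta>\<^sup>2"]
    by (intro DERIV_cong[OF DERIV_divide]) (auto intro!: derivative_eq_intros)
qed

lemma cutoff_eq_0: "y \<le> \<delta> \<Longrightarrow> cutoff \<delta> y = 0"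
  by (simp add: cutoff_def)

lemma continuous_on_cutoff_deriv:
  assumes "\<delta> > 0"
  shows "continuous_on UNIV (cutoff_deriv \<delta>)"
proof -
  have "y\<^sup>2 + \<delta>\<^sup>2 \<noteq> 0" for y :: real
    using assms by (simp add: sum_power2_eq_zero_iff)
  then show ?thesis
    unfolding cutoff_deriv_def[abs_def] by (intro continuous_intros) auto
qed

text \<open>The two terms of the quotient rule are nonnegative and at most \<open>2 / y\<close>
  each, because the positive part is at most \<open>y\<close> and the denominator at least
  \<open>y\<^sup>2\<close>. This makes the bounds independent of \<open>\<delta>\<close>.\<close>

lemma cutoff_bounds:
  assumes "\<delta> > 0" "y > 0"
  shows "\<bar>cutoff \<delta> y\<bar> \<le> 1" "\<bar>cutoff_deriv \<delta> y\<bar> \<le> 4 / y"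
proof -
  define m where "m = max 0 (y - \<delta>)"
  define d where "d = y\<^sup>2 + \<delta>\<^sup>2"
  have m: "0 \<le> m" "m \<le> y" using assms by (auto simp: m_def)
  have d: "0 < d" "y\<^sup>2 \<le> d" using assms by (auto simp: d_def intro: add_pos_nonneg)
  have my: "m\<^sup>2 \<le> y\<^sup>2" using m by (intro power_mono)
  then show "\<bar>cutoff \<delta> y\<bar> \<le> 1"
    using d by (simp add: cutoff_def m_def[symmetric] d_def[symmetric])
  have "cutoff_deriv \<delta> y = 2 * m / d - m\<^sup>2 * (2 * y) / d\<^sup>2"
    unfolding cutoff_deriv_def m_def[symmetric] d_def[symmetric]
    using d by (simp add: diff_divide_distrib power2_eq_square[of d])
  moreover have "0 \<le> 2 * m / d" "2 * m / d \<le> 2 / y"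
  proof -
    have "2 * m / d \<le> 2 * y / y\<^sup>2" using m d assms by (intro frac_le) auto
    then show "2 * m / d \<le> 2 / y" using assms by (simp add: power2_eq_square)
  qed (use m d in auto)
  moreover have "0 \<le> m\<^sup>2 * (2 * y) / d\<^sup>2" "m\<^sup>2 * (2 * y) / d\<^sup>2 \<le> 2 / y"
  proof -
    have "m\<^sup>2 * (2 * y) / d\<^sup>2 \<le> y\<^sup>2 * (2 * y) / (y\<^sup>2)\<^sup>2"
      using m d my assms by (intro frac_le mult_right_mono power_mono) auto
    then show "m\<^sup>2 * (2 * y) / d\<^sup>2 \<le> 2 / y" using assms by (simp add: power2_eq_square)
  qed (use m d assms in auto)
  moreover have "4 / y = 2 / y + 2 / y" by simp
  moreover have "0 \<le> 2 / y" using assms by simp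
  ultimately show "\<bar>cutoff_deriv \<delta> y\<bar> \<le> 4 / y"
    by linarith
qed

lemma cutoff_tendsto:
  assumes "y > 0" "\<delta> \<longlonglongrightarrow> 0"
  shows "(\<lambda>m::nat. cutoff (\<delta> m) y) \<longlonglongrightarrow> 1" "(\<lambda>m. cutoff_deriv (\<delta> m) y) \<longlonglongrightarrow> 0"
proof -
  have "(\<lambda>m. cutoff (\<delta> m) y) \<longlonglongrightarrow> (max 0 (y - 0))\<^sup>2 / (y\<^sup>2 + 0\<^sup>2)"
    unfolding cutoff_def using assms by (intro tendsto_intros) auto
  then show "(\<lambda>m. cutoff (\<delta> m) y) \<longlonglongrightarrow> 1" using assms by simp
  have "(\<lambda>m. cutoff_deriv (\<delta> m) y) \<longlonglongrightarrow>
    (2 * max 0 (y - 0) * (y\<^sup>2 + 0\<^sup>2) - (max 0 (y - 0))\<^sup>2 * (2 * y)) / (y\<^sup>2 + 0\<^sup>2)\<^sup>2"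
    unfolding cutoff_deriv_def using assms by (intro tendsto_intros) auto
  then show "(\<lambda>m. cutoff_deriv (\<delta> m) y) \<longlonglongrightarrow> 0" using assms by (simp add: power2_eq_square)
qed

section \<open>Derivatives of products over coordinates, and integration by parts without boundary
  terms\<close>

lemma gderiv_coordinate_product:
  fixes F F' :: "'n::finite \<Rightarrow> real \<Rightarrow> real" and x :: "real^'n"
  assumes "\<And>j t. (F j has_real_derivative F' j t) (at t)"
  shows "GDERIV (\<lambda>x. \<Prod>j\<in>UNIV. F j (x $ j)) x :> (\<chi> i. F' i (x $ i) * (\<Prod>j\<in>UNIV - {i}. F j (x $ j)))"
proof -
  have "((\<lambda>x. F j (x $ j)) has_derivative (\<lambda>h. F' j (x $ j) * h $ j)) (at x)" for j
  proof -
    have "((\<lambda>x. x $ j) has_derivative (\<lambda>h. h $ j)) (at x)"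
      by (rule bounded_linear_imp_has_derivative[OF bounded_linear_vec_nth])
    from has_derivative_compose[OF this, of "F j" "\<lambda>h. F' j (x $ j) * h"]
    show ?thesis using assms by (simp add: has_field_derivative_def)
  qed
  then have "((\<lambda>x. \<Prod>j\<in>UNIV. F j (x $ j)) has_derivative
      (\<lambda>h. \<Sum>i\<in>UNIV. (F' i (x $ i) * h $ i) * (\<Prod>j\<in>UNIV - {i}. F j (x $ j)))) (at x)"
    by (intro has_derivative_prod)
  then show ?thesis
    unfolding gderiv_def by (simp add: inner_vec_def mult_ac)
qed

lemma continuous_on_coordinate_product_gradient:
  fixes F F' :: "'n::finite \<Rightarrow> real \<Rightarrow> real"
  assumes "\<And>j. continuous_on UNIV (F j)" "\<And>j. continuous_on UNIV (F' j)"
  shows "continuous_on UNIV (\<lambda>x::real^'n. \<chi> i. F' i (x $ i) * (\<Prod>j\<in>UNIV - {i}. F j (x $ j)))"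
  by (intro continuous_intros continuous_on_compose2[OF assms(1)] continuous_on_compose2[OF assms(2)]) auto

lemma gderiv_continuous_on:
  assumes "\<And>x. GDERIV f x :> G x"
  shows "continuous_on UNIV f"
  using assms unfolding gderiv_def
  by (meson continuous_at_imp_continuous_on has_derivative_continuous)

lemma integral_lborel_translate:
  fixes f :: "'a::euclidean_space \<Rightarrow> real"
  assumes "f \<in> borel_measurable borel"
  shows "(\<integral>x. f (a + x) \<partial>lborel) = (\<integral>x. f x \<partial>lborel)"
proof -
  have "(\<integral>x. f x \<partial>lborel) = (\<integral>x. f x \<partial>(distr lborel borel ((+) a)))"
    by (simp add: lborel_distr_plus)
  also have "\<dots> = (\<integral>x. f (a + x) \<partial>lborel)"
    using assms by (intro integral_distr) auto
  finally show ?thesis by simp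
qed

text \<open>By translation invariance all difference quotients have integral zero.\<close>

lemma integral_partial_derivative_eq_0:
  fixes \<zeta> :: "real^'n \<Rightarrow> real"
  assumes G: "\<And>x. GDERIV \<zeta> x :> G x" and contG: "continuous_on UNIV G"
    and R: "\<And>x. \<zeta> x \<noteq> 0 \<Longrightarrow> norm x \<le> R"
  shows "(\<integral>x. G x $ i \<partial>lborel) = 0"
proof -
  define e :: "real^'n" where "e = axis i 1"
  define h where "h m = inverse (real (Suc m))" for m
  have h: "0 < h m" "h m \<le> 1" for m by (auto simp: h_def field_simps)
  define D where "D m x = (\<zeta> (h m *\<^sub>R e + x) - \<zeta> x) / h m" for m x
  have cont: "continuous_on UNIV \<zeta>" using gderiv_continuous_on[OF G] .
  have [measurable]: "\<zeta> \<in> borel_measurable borel" by (rule borel_measurable_continuous_onI[OF cont])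
  have ne: "norm e = 1" by (simp add: e_def norm_axis_1)
  have "bounded (G ` cball 0 (R + 2))"
    by (intro compact_imp_bounded compact_continuous_image continuous_on_subset[OF contG]) auto
  then obtain B where B: "B > 0" "\<And>x. norm x \<le> R + 2 \<Longrightarrow> norm (G x) \<le> B"
    by (auto simp: bounded_pos)
  have line: "((\<lambda>r. \<zeta> (r *\<^sub>R e + x)) has_real_derivative G (r *\<^sub>R e + x) $ i) (at r)" for r x
  proof -
    have "((\<lambda>r. r *\<^sub>R e + x) has_derivative (\<lambda>t. t *\<^sub>R e)) (at r)"
      by (auto intro!: derivative_eq_intros)
    from has_derivative_compose[OF this G[unfolded gderiv_def]]
    show ?thesis by (simp add: has_field_derivative_def e_def inner_axis' mult_commute_abs)
  qed
  have supp: "integrable lborel \<zeta>"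
  proof -
    have "integrable lborel (\<lambda>x. indicator (cball 0 R) x *\<^sub>R \<zeta> x)"
      by (rule borel_integrable_compact) (auto intro: continuous_on_subset[OF cont])
    moreover have "(\<lambda>x. indicator (cball 0 R) x *\<^sub>R \<zeta> x) = \<zeta>"
      using R by (fastforce simp: indicator_def)
    ultimately show ?thesis by simp
  qed
  have int0: "(\<integral>x. D m x \<partial>lborel) = 0" for m
  proof -
    have "integrable (distr lborel borel ((+) (h m *\<^sub>R e))) \<zeta>"
      using supp by (simp add: lborel_distr_plus)
    then have "integrable lborel (\<lambda>x. \<zeta> (h m *\<^sub>R e + x))"
      by (subst (asm) integrable_distr_eq) auto
    then have "(\<integral>x. D m x \<partial>lborel) = ((\<integral>x. \<zeta> (h m *\<^sub>R e + x) \<partial>lborel) - (\<integral>x. \<zeta> x \<partial>lborel)) / h m"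
      unfolding D_def using supp by simp
    then show ?thesis by (simp add: integral_lborel_translate)
  qed
  have "(\<lambda>m. \<integral>x. D m x \<partial>lborel) \<longlonglongrightarrow> (\<integral>x. G x $ i \<partial>lborel)"
  proof (rule integral_dominated_convergence[where w = "\<lambda>x. B * indicator (cball 0 (R + 1)) x"])
    show "(\<lambda>x. G x $ i) \<in> borel_measurable lborel"
      by (simp, intro borel_measurable_continuous_onI continuous_intros contG)
    show "D m \<in> borel_measurable lborel" for m unfolding D_def[abs_def] by measurable
    \<comment> \<open>Shifts have length at most 1, so the difference quotients vanish beyond radius
      \<open>R + 1\<close>, and the intermediate point of the mean value theorem stays within
      \<open>R + 2\<close>, where \<open>B\<close> bounds the gradient.\<close>
    show "integrable lborel (\<lambda>x. B * indicator (cball 0 (R + 1)) x :: real)"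
      by (intro integrable_mult_right integrable_real_indicator)
        (use emeasure_lborel_cball_finite[of 0 "R + 1"] in auto)
    show "AE x in lborel. (\<lambda>m. D m x) \<longlonglongrightarrow> G x $ i"
    proof (rule AE_I2)
      fix x
      have "((\<lambda>r. (\<zeta> (r *\<^sub>R e + x) - \<zeta> (0 *\<^sub>R e + x)) / (r - 0)) \<longlongrightarrow> G (0 *\<^sub>R e + x) $ i) (at 0)"
        using line[of x 0] by (simp add: has_field_derivative_iff)
      moreover have "filterlim h (at 0) sequentially"
        unfolding filterlim_at using h LIMSEQ_inverse_real_of_nat
        by (auto simp: h_def[abs_def] intro!: always_eventually)
      ultimately have "(\<lambda>m. (\<zeta> (h m *\<^sub>R e + x) - \<zeta> (0 *\<^sub>R e + x)) / (h m - 0)) \<longlonglongrightarrow> G (0 *\<^sub>R e + x) $ i"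
        by (rule filterlim_compose)
      then show "(\<lambda>m. D m x) \<longlonglongrightarrow> G x $ i" by (simp add: D_def)
    qed
    show "AE x in lborel. norm (D m x) \<le> B * indicator (cball 0 (R + 1)) x" for m
    proof (rule AE_I2)
      fix x
      show "norm (D m x) \<le> B * indicator (cball 0 (R + 1)) x"
      proof (cases "norm x \<le> R + 1")
        case True
        obtain z where z: "0 < z" "z < h m"
          "\<zeta> (h m *\<^sub>R e + x) - \<zeta> (0 *\<^sub>R e + x) = (h m - 0) * G (z *\<^sub>R e + x) $ i"
          using MVT2[of 0 "h m" "\<lambda>r. \<zeta> (r *\<^sub>R e + x)" "\<lambda>r. G (r *\<^sub>R e + x) $ i"] h[of m] line by auto
        then have "D m x = G (z *\<^sub>R e + x) $ i" using h[of m] by (simp add: D_def)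
        also have "norm \<dots> \<le> norm (G (z *\<^sub>R e + x))" by (simp add: component_le_norm_cart)
        also have "\<dots> \<le> B"
        proof (rule B(2))
          have "norm (z *\<^sub>R e + x) \<le> norm (z *\<^sub>R e) + norm x" by (rule norm_triangle_ineq)
          also have "\<dots> \<le> R + 2" using z h[of m] True ne by simp
          finally show "norm (z *\<^sub>R e + x) \<le> R + 2" .
        qed
        finally show ?thesis using True by simp
      next
        case False
        have "norm x - norm (h m *\<^sub>R e) \<le> norm (h m *\<^sub>R e + x)"
          by (metis add.commute norm_diff_ineq)
        then have "norm (h m *\<^sub>R e + x) > R" using False h[of m] ne by simp
        then have "D m x = 0" using False R[of x] R[of "h m *\<^sub>R e + x"] by (force simp: D_def)
        then show ?thesis using B by simp
      qed
    qed
  qed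
  then show ?thesis using int0 LIMSEQ_unique by (simp add: LIMSEQ_const_iff)
qed

lemma gderiv_eq_0_outside_support:
  assumes "GDERIV \<eta> x :> G" "x \<notin> closure {x. \<eta> x \<noteq> 0}"
  shows "G = 0"
proof -
  have "((\<lambda>x. 0) has_derivative (\<lambda>h. h \<bullet> G)) (at x)"
    by (rule has_derivative_transform_within_open[of \<eta> _ _ _ "- closure {x. \<eta> x \<noteq> 0}"])
      (use assms closure_subset[of "{x. \<eta> x \<noteq> 0}"] in \<open>auto simp: gderiv_def\<close>)
  then have "(\<lambda>h. h \<bullet> G) = (\<lambda>h. 0)"
    using has_derivative_unique has_derivative_const by blast
  then have "G \<bullet> G = 0" by metis
  then show ?thesis by simp
qed

lemma integral_lebesgue_on_eq_lborel:
  fixes f :: "real^'n \<Rightarrow> real"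
  assumes "S \<in> sets lebesgue" "continuous_on UNIV f" "\<And>x. x \<notin> S \<Longrightarrow> f x = 0"
  shows "(\<integral>x. f x \<partial>(lebesgue_on S)) = (\<integral>x. f x \<partial>lborel)"
proof -
  have "(\<integral>x. f x \<partial>(lebesgue_on S)) = (\<integral>x. indicator S x *\<^sub>R f x \<partial>lebesgue)"
    using assms(1) by (intro integral_restrict_space) auto
  also have "(\<lambda>x. indicator S x *\<^sub>R f x) = f"
    using assms(3) by (fastforce simp: indicator_def)
  also have "(\<integral>x. f x \<partial>lebesgue) = (\<integral>x. f x \<partial>lborel)"
    using assms(2) by (intro integral_completion) (auto intro: borel_measurable_continuous_onI)
  finally show ?thesis .
qed

text \<open>The product of \<open>f\<close> with a test function has compact support in the cube, so
  its partial derivatives have integral zero; the product rule turns this into the defining identity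
  of the weak gradient. The values of \<open>f\<close> on the boundary are unrestricted.\<close>

lemma H1_gradient_C1:
  fixes f :: "real^'n \<Rightarrow> real"
  assumes f: "\<And>x. GDERIV f x :> g x" and contg: "continuous_on UNIV g"
  shows "H1_gradient unit_cube f g"
  unfolding H1_gradient_def
proof (intro conjI allI impI)
  have contf: "continuous_on UNIV f" using gderiv_continuous_on[OF f] .
  then show "L2_fun unit_cube f" by (rule L2_fun_continuous)
  have contgi: "continuous_on UNIV (\<lambda>x. g x $ i)" for i
    by (intro continuous_intros contg)
  then show "L2_fun unit_cube (\<lambda>x. g x $ i)" for i
    by (rule L2_fun_continuous)
  fix \<eta> :: "real^'n \<Rightarrow> real" and G and i assume "test_function unit_cube \<eta> G"
  then have \<eta>: "\<And>x. GDERIV \<eta> x :> G x" and contG: "continuous_on UNIV G"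
    and cpt: "compact (closure {x. \<eta> x \<noteq> 0})" and sub: "closure {x. \<eta> x \<noteq> 0} \<subseteq> unit_cube"
    by (auto simp: test_function_def)
  have cont\<eta>: "continuous_on UNIV \<eta>" using gderiv_continuous_on[OF \<eta>] .
  have contGi: "continuous_on UNIV (\<lambda>x. G x $ i)" by (intro continuous_intros contG)
  define H where "H x = f x *\<^sub>R G x + \<eta> x *\<^sub>R g x" for x
  have Hd: "GDERIV (\<lambda>x. f x * \<eta> x) x :> H x" for x
    unfolding H_def by (rule GDERIV_mult[OF f \<eta>])
  have contH: "continuous_on UNIV H"
    unfolding H_def[abs_def] by (intro continuous_intros contf contG cont\<eta> contg)
  obtain R where R: "\<And>x. x \<in> closure {x. \<eta> x \<noteq> 0} \<Longrightarrow> norm x \<le> R"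
    using compact_imp_bounded[OF cpt] by (auto simp: bounded_iff)
  have "(\<integral>x. H x $ i \<partial>lborel) = 0"
    using R closure_subset[of "{x. \<eta> x \<noteq> 0}"]
    by (intro integral_partial_derivative_eq_0[OF Hd contH, of R]) auto
  moreover have "(\<integral>x. H x $ i \<partial>(lebesgue_on unit_cube)) = (\<integral>x. H x $ i \<partial>lborel)"
  proof (rule integral_lebesgue_on_eq_lborel)
    fix x :: "real^'n" assume "x \<notin> unit_cube"
    then have "x \<notin> closure {x. \<eta> x \<noteq> 0}" using sub by auto
    then have "G x = 0" "\<eta> x = 0"
      using gderiv_eq_0_outside_support[OF \<eta>] closure_subset[of "{x. \<eta> x \<noteq> 0}"] by auto
    then show "H x $ i = 0" by (simp add: H_def)
  qed (auto intro!: continuous_intros contH)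
  moreover have "(\<integral>x. H x $ i \<partial>(lebesgue_on unit_cube)) =
     L2_inner unit_cube f (\<lambda>x. G x $ i) + L2_inner unit_cube (\<lambda>x. g x $ i) \<eta>"
    unfolding H_def L2_inner_def
    by (subst Bochner_Integration.integral_add[symmetric])
       (auto intro!: cube_integrable_continuous continuous_intros contf contGi cont\<eta> contgi
         simp: mult.commute)
  ultimately show "L2_inner unit_cube f (\<lambda>x. G x $ i) = - L2_inner unit_cube (\<lambda>x. g x $ i) \<eta>"
    by simp
qed

section \<open>Products of cosines as Neumann eigenfunctions\<close>

text \<open>Integer frequencies, with k and -k giving the same function, let the product-to-sum
  formula use \<open>k i - m\<close> without a case distinction.\<close>

definition cosine_product :: "('n::finite \<Rightarrow> int) \<Rightarrow> real^'n \<Rightarrow> real" where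
  "cosine_product k x = (\<Prod>j\<in>UNIV. cos (pi * k j * x $ j))"

definition cosine_gradient :: "('n::finite \<Rightarrow> int) \<Rightarrow> real^'n \<Rightarrow> real^'n" where
  "cosine_gradient k x = (\<chi> i. - (pi * k i) * sin (pi * k i * x $ i) * (\<Prod>j\<in>UNIV - {i}. cos (pi * k j * x $ j)))"

definition cosine_eigenvalue :: "('n::finite \<Rightarrow> int) \<Rightarrow> real" where
  "cosine_eigenvalue k = (\<Sum>i\<in>UNIV. (pi * k i)\<^sup>2)"

lemma continuous_on_cosine_product: "continuous_on S (cosine_product k)"
  unfolding cosine_product_def[abs_def] by (intro continuous_intros)

lemma continuous_on_cosine_gradient: "continuous_on S (cosine_gradient k)"
  unfolding cosine_gradient_def[abs_def] by (intro continuous_intros)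

lemma L2_fun_cosine_product: "L2_fun unit_cube (cosine_product k)"
  by (intro L2_fun_continuous continuous_on_cosine_product)

lemma gderiv_cosine_product: "GDERIV (cosine_product k) x :> cosine_gradient k x"
proof -
  have "GDERIV (\<lambda>x. \<Prod>j\<in>UNIV. cos (pi * k j * x $ j)) x :>
      (\<chi> i. (- (pi * k i) * sin (pi * k i * x $ i)) * (\<Prod>j\<in>UNIV - {i}. cos (pi * k j * x $ j)))"
    by (rule gderiv_coordinate_product) (auto intro!: derivative_eq_intros)
  then show ?thesis
    by (simp add: cosine_product_def[abs_def] cosine_gradient_def)
qed

lemma H1_gradient_cosine_product: "H1_gradient unit_cube (cosine_product k) (cosine_gradient k)"
  by (intro H1_gradient_C1 gderiv_cosine_product continuous_on_cosine_gradient)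

text \<open>The factor \<open>t * (1 - t)\<close> is the argument at which the cutoff is taken, so
  it cancels the bound \<open>4 / y\<close> there. The sine is linearly small at 0, and at 1 by the
  reflection of \<open>t\<close> to \<open>1 - t\<close>, which preserves its absolute value at
  integer frequency; finally \<open>min t (1 - t)\<close> is at most
  \<open>2 * (t * (1 - t))\<close>.\<close>

lemma abs_sin_int_pi_le:
  fixes k :: int
  assumes "0 \<le> t" "t \<le> 1"
  shows "\<bar>sin (pi * k * t)\<bar> \<le> 2 * pi * \<bar>k\<bar> * (t * (1 - t))"
proof -
  have *: "\<bar>sin (pi * k * t)\<bar> \<le> pi * \<bar>k\<bar> * \<bar>t\<bar>" for t
    using abs_sin_x_le_abs_x[of "pi * k * t"] by (simp add: abs_mult)
  have sk: "sin (pi * k) = 0"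
    by (metis mult.commute sin_npi_int)
  then have "\<bar>cos (pi * k)\<bar> = 1"
    using sin_cos_squared_add[of "pi * k"] by (simp add: power2_eq_1_iff)
  moreover have "sin (pi * k * (1 - t)) = - cos (pi * k) * sin (pi * k * t)"
    using sk by (simp add: right_diff_distrib sin_diff)
  ultimately have "\<bar>sin (pi * k * t)\<bar> = \<bar>sin (pi * k * (1 - t))\<bar>"
    by (simp add: abs_mult)
  then have "\<bar>sin (pi * k * t)\<bar> \<le> pi * \<bar>k\<bar> * \<bar>1 - t\<bar>" "\<bar>sin (pi * k * t)\<bar> \<le> pi * \<bar>k\<bar> * \<bar>t\<bar>"
    using *[of t] *[of "1 - t"] by auto
  then have "\<bar>sin (pi * k * t)\<bar> \<le> pi * \<bar>k\<bar> * min t (1 - t)"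
    using assms by (auto simp: min_def)
  also have "\<dots> \<le> pi * \<bar>k\<bar> * (2 * (t * (1 - t)))"
  proof (intro mult_left_mono)
    show "min t (1 - t) \<le> 2 * (t * (1 - t))"
    proof (cases "t \<le> 1/2")
      case True
      then have "t * 1 \<le> t * (2 * (1 - t))" using assms by (intro mult_left_mono) auto
      then show ?thesis by (intro min.coboundedI1) (simp add: algebra_simps)
    next
      case False
      then have "1 * (1 - t) \<le> (2 * t) * (1 - t)" using assms by (intro mult_right_mono) auto
      then show ?thesis by (intro min.coboundedI2) (simp add: algebra_simps)
    qed
  qed auto
  finally show ?thesis by (simp add: mult_ac)
qed

text \<open>The \<open>i\<close>-th partial derivative of a cosine product vanishes on the faces \<open>x\<^sub>i = 0, 1\<close> only, so it is
  cut off in every coordinate. Its linear decay at these two faces compensates the growth of the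
  derivative of the cutoff; in the other coordinates the cutoff is not differentiated.\<close>

lemma H1_cosine_by_parts:
  fixes u :: "real^'n \<Rightarrow> real"
  assumes H1: "H1_gradient unit_cube u g"
  shows "L2_inner unit_cube (\<lambda>x. g x $ i) (\<lambda>x. cosine_gradient k x $ i)
    = (pi * k i)\<^sup>2 * L2_inner unit_cube u (cosine_product k)"
proof -
  define \<delta> where "\<delta> m = inverse (real (Suc m))" for m
  have \<delta>0: "\<delta> m > 0" for m by (simp add: \<delta>_def)
  have \<delta>lim: "\<delta> \<longlonglongrightarrow> 0" unfolding \<delta>_def[abs_def] by (rule LIMSEQ_inverse_real_of_nat)
  \<comment> \<open>The product \<open>t * (1 - t)\<close> is comparable to the distance from the
    endpoints 0 and 1, so one cutoff treats both faces.\<close>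
  define \<chi>\<chi> where "\<chi>\<chi> m t = cutoff (\<delta> m) (t * (1 - t))" for m t
  define \<chi>' where "\<chi>' m t = cutoff_deriv (\<delta> m) (t * (1 - t)) * (1 - 2 * t)" for m t
  \<comment> \<open>The product \<open>f0\<close> of the \<open>b j\<close> is the i-th partial
    derivative of the cosine product without its factor \<open>- (pi * k i)\<close>; dropping the
    factor avoids a division when \<open>k i = 0\<close>. Its own i-th derivative \<open>f1\<close>
    is \<open>pi * k i\<close> times the cosine product.\<close>
  define b where "b j t = (if j = i then sin (pi * k i * t) else cos (pi * k j * t))" for j t
  define b' where "b' j t = (if j = i then (pi * k i) * cos (pi * k i * t) else - (pi * k j) * sin (pi * k j * t))" for j t
  define F where "F m j t = \<chi>\<chi> m t * b j t" for m j t
  define F' where "F' m j t = \<chi>' m t * b j t + \<chi>\<chi> m t * b' j t" for m j t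
  define \<eta> where "\<eta> m x = (\<Prod>j\<in>UNIV. F m j (x $ j))" for m and x :: "real^'n"
  define G where "G m x = (\<chi> l. F' m l (x $ l) * (\<Prod>j\<in>UNIV - {l}. F m j (x $ j)))" for m and x :: "real^'n"
  define f0 where "f0 x = (\<Prod>j\<in>UNIV. b j (x $ j))" for x :: "real^'n"
  define f1 where "f1 x = b' i (x $ i) * (\<Prod>j\<in>UNIV - {i}. b j (x $ j))" for x :: "real^'n"
  \<comment> \<open>The 9 is 8 + 1: the cutoff derivative (at most 4 over
    \<open>t * (1 - t)\<close>) times the sine bound gives 8, and the derivative of the sine gives
    1.\<close>
  define C where "C = 9 * (pi * \<bar>k i\<bar>)"
  have \<chi>d: "(\<chi>\<chi> m has_real_derivative \<chi>' m t) (at t)" for m t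
    unfolding \<chi>\<chi>_def[abs_def] \<chi>'_def
    by (rule DERIV_chain2[OF cutoff_has_derivative[OF \<delta>0]]) (auto intro!: derivative_eq_intros)
  have bd: "(b j has_real_derivative b' j t) (at t)" for j t
    unfolding b_def[abs_def] b'_def by (auto intro!: derivative_eq_intros)
  have Fd: "(F m j has_real_derivative F' m j t) (at t)" for m j t
    unfolding F_def[abs_def] F'_def by (rule DERIV_cong[OF DERIV_mult[OF \<chi>d bd]]) (simp add: mult.commute)
  have cont\<chi>: "continuous_on UNIV (\<chi>\<chi> m)" for m
    using \<chi>d by (meson DERIV_isCont continuous_at_imp_continuous_on)
  have contb: "continuous_on UNIV (b j)" for j
    using bd by (meson DERIV_isCont continuous_at_imp_continuous_on)
  have contF: "continuous_on UNIV (F m j)" for m j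
    using Fd by (meson DERIV_isCont continuous_at_imp_continuous_on)
  have contF': "continuous_on UNIV (F' m j)" for m j
  proof -
    have "continuous_on UNIV (\<chi>' m)"
      unfolding \<chi>'_def[abs_def]
      by (intro continuous_intros continuous_on_compose2[OF continuous_on_cutoff_deriv[OF \<delta>0]]) auto
    moreover have "continuous_on UNIV (b' j)"
      unfolding b'_def[abs_def] by (cases "j = i") (auto intro!: continuous_intros)
    ultimately show ?thesis
      unfolding F'_def[abs_def] by (intro continuous_intros cont\<chi> contb)
  qed
  have d\<eta>: "GDERIV (\<eta> m) x :> G m x" for m x
    unfolding \<eta>_def[abs_def] G_def by (rule gderiv_coordinate_product) (rule Fd)
  have contG: "continuous_on UNIV (G m)" for m
    unfolding G_def[abs_def] by (intro continuous_on_coordinate_product_gradient contF contF')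
  have test: "test_function unit_cube (\<eta> m) (G m)" for m
  proof -
    \<comment> \<open>The cutoff vanishes wherever its argument is at most
      \<open>\<delta> m\<close>. Non-strict inequalities make \<open>K\<close> closed, and a
      positive value of \<open>t * (1 - t)\<close> forces \<open>t\<close> into the open interval,
      so \<open>K\<close> stays off the boundary.\<close>
    define K where "K = {x :: real^'n. \<forall>j. \<delta> m \<le> x $ j * (1 - x $ j)}"
    have "K = (\<Inter>j. {x. \<delta> m \<le> x $ j * (1 - x $ j)})" by (auto simp: K_def)
    also have "closed \<dots>"
      by (intro closed_INT ballI closed_Collect_le continuous_intros)
    finally have "closed K" .
    have "{x. \<eta> m x \<noteq> 0} \<subseteq> K"
    proof
      fix x assume "x \<in> {x. \<eta> m x \<noteq> 0}"
      then have "F m j (x $ j) \<noteq> 0" for j by (auto simp: \<eta>_def)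
      then have "\<chi>\<chi> m (x $ j) \<noteq> 0" for j by (auto simp: F_def)
      then show "x \<in> K"
        unfolding K_def \<chi>\<chi>_def using cutoff_eq_0[of _ "\<delta> m"] linear by blast
    qed
    then have cl: "closure {x. \<eta> m x \<noteq> 0} \<subseteq> K" using \<open>closed K\<close> by (rule closure_minimal)
    have "K \<subseteq> unit_cube"
    proof
      fix x assume "x \<in> K"
      have "0 < x $ j \<and> x $ j < 1" for j
      proof -
        have "\<delta> m \<le> x $ j * (1 - x $ j)" using \<open>x \<in> K\<close> by (simp add: K_def)
        then have "0 < x $ j * (1 - x $ j)" using \<delta>0[of m] by linarith
        then show ?thesis by (auto simp: zero_less_mult_iff)
      qed
      then show "x \<in> unit_cube" by (simp add: unit_cube_def)
    qed
    moreover have "bounded (unit_cube :: (real^'n) set)" by (simp add: unit_cube_eq_box)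
    ultimately have "bounded (closure {x. \<eta> m x \<noteq> 0})"
      using cl bounded_subset by (metis subset_trans)
    then have "compact (closure {x. \<eta> m x \<noteq> 0})" by (simp add: compact_eq_bounded_closed)
    moreover have "closure {x. \<eta> m x \<noteq> 0} \<subseteq> unit_cube"
      using cl \<open>K \<subseteq> unit_cube\<close> by (rule subset_trans)
    ultimately show ?thesis
      unfolding test_function_def using d\<eta> contG by simp
  qed
  have u: "L2_fun unit_cube u" and g: "L2_fun unit_cube (\<lambda>x. g x $ i)"
    using H1 by (auto simp: H1_gradient_def)
  have um: "u \<in> borel_measurable (lebesgue_on unit_cube)" and gm: "(\<lambda>x. g x $ i) \<in> borel_measurable (lebesgue_on unit_cube)"
    using u g by (auto simp: L2_fun_def)
  have L1: "integrable (lebesgue_on unit_cube) (\<lambda>x. C * \<bar>v x\<bar>)" if "L2_fun unit_cube v" for C and v :: "real^'n \<Rightarrow> real"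
    using L2_fun_integrable_mult[OF that L2_fun_continuous[of "\<lambda>x. 1"]]
    by (intro integrable_mult_right integrable_abs) auto
  have ibp: "L2_inner unit_cube u (\<lambda>x. G m x $ i) = - L2_inner unit_cube (\<lambda>x. g x $ i) (\<eta> m)" for m
    using H1 test by (auto simp: H1_gradient_def)
  have w: "0 < x $ j * (1 - x $ j)" "x $ j * (1 - x $ j) \<le> 1" if "x \<in> unit_cube" for x :: "real^'n" and j
    using that mult_le_one[of "x $ j" "1 - x $ j"] by (auto simp: unit_cube_def less_imp_le)
  have \<chi>1: "\<bar>\<chi>\<chi> m (x $ j)\<bar> \<le> 1" if "x \<in> unit_cube" for x :: "real^'n" and j m
    unfolding \<chi>\<chi>_def by (intro cutoff_bounds \<delta>0 w that)
  have F1: "\<bar>F m j (x $ j)\<bar> \<le> 1" if "x \<in> unit_cube" for x :: "real^'n" and j m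
    using \<chi>1[OF that, of m j] unfolding F_def abs_mult by (intro mult_le_one) (auto simp: b_def)
  have F'1: "\<bar>F' m i (x $ i)\<bar> \<le> C" if "x \<in> unit_cube" for x :: "real^'n" and m
  proof -
    define t where "t = x $ i"
    have t: "0 < t" "t < 1" using that by (auto simp: unit_cube_def t_def)
    have wt: "0 < t * (1 - t)" using t by auto
    have "\<bar>\<chi>' m t * b i t\<bar> \<le> (4 / (t * (1 - t)) * 1) * (2 * pi * \<bar>k i\<bar> * (t * (1 - t)))"
      unfolding abs_mult
    proof (intro mult_mono)
      show "\<bar>\<chi>' m t\<bar> \<le> 4 / (t * (1 - t)) * 1"
        unfolding \<chi>'_def abs_mult using wt t by (intro mult_mono cutoff_bounds \<delta>0) auto
      show "\<bar>b i t\<bar> \<le> 2 * pi * \<bar>k i\<bar> * (t * (1 - t))"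
        using abs_sin_int_pi_le[of t "k i"] t by (simp add: b_def)
    qed (use wt in auto)
    also have "\<dots> = 8 * (pi * \<bar>k i\<bar>)" using t by (simp add: field_simps)
    finally have 1: "\<bar>\<chi>' m t * b i t\<bar> \<le> 8 * (pi * \<bar>k i\<bar>)" .
    have "\<bar>\<chi>\<chi> m t * b' i t\<bar> \<le> 1 * (pi * \<bar>k i\<bar> * 1)"
      unfolding abs_mult
      by (intro mult_mono) (use \<chi>1[OF that, of m i] in \<open>auto simp: t_def b'_def abs_mult mult_left_le\<close>)
    then show ?thesis using 1 unfolding F'_def C_def t_def[symmetric] by linarith
  qed
  have prodF: "\<bar>\<Prod>j\<in>A. F m j (x $ j)\<bar> \<le> 1" if "x \<in> unit_cube" for x :: "real^'n" and m A
    unfolding abs_prod using F1[OF that] by (intro prod_le_1) auto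
  have limF: "(\<lambda>m. F m j (x $ j)) \<longlonglongrightarrow> b j (x $ j)" if "x \<in> unit_cube" for x :: "real^'n" and j
  proof -
    have "(\<lambda>m. F m j (x $ j)) \<longlonglongrightarrow> 1 * b j (x $ j)"
      unfolding F_def \<chi>\<chi>_def by (intro tendsto_intros cutoff_tendsto \<delta>lim w that)
    then show ?thesis by simp
  qed
  have limF': "(\<lambda>m. F' m j (x $ j)) \<longlonglongrightarrow> b' j (x $ j)" if "x \<in> unit_cube" for x :: "real^'n" and j
  proof -
    have "(\<lambda>m. F' m j (x $ j)) \<longlonglongrightarrow> 0 * (1 - 2 * (x $ j)) * b j (x $ j) + 1 * b' j (x $ j)"
      unfolding F'_def \<chi>'_def \<chi>\<chi>_def by (intro tendsto_intros cutoff_tendsto \<delta>lim w that)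
    then show ?thesis by simp
  qed
  have contGi: "continuous_on UNIV (\<lambda>x. G m x $ i)" for m by (intro continuous_intros contG)
  have cont\<eta>: "continuous_on UNIV (\<eta> m)" for m using gderiv_continuous_on[OF d\<eta>] .
  have contf0: "continuous_on UNIV f0"
    unfolding f0_def[abs_def] by (intro continuous_intros continuous_on_compose2[OF contb]) auto
  have contf1: "continuous_on UNIV f1"
  proof -
    have "f1 = (\<lambda>x. (pi * k i) * cos (pi * k i * x $ i) * (\<Prod>j\<in>UNIV - {i}. b j (x $ j)))"
      by (simp add: f1_def[abs_def] b'_def)
    then show ?thesis
      by (simp only:) (intro continuous_intros continuous_on_compose2[OF contb], auto)
  qed
  \<comment> \<open>Only the i-th derivative of the test function occurs, so \<open>F'1\<close> is
    needed in that coordinate alone and the other factors are bounded by 1. The majorant is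
    integrable because square integrable functions on the cube are integrable.\<close>
  have "(\<lambda>m. L2_inner unit_cube u (\<lambda>x. G m x $ i)) \<longlonglongrightarrow> L2_inner unit_cube u f1"
    unfolding L2_inner_def
  proof (rule integral_dominated_convergence[where w = "\<lambda>x. C * \<bar>u x\<bar>"])
    show "AE x in lebesgue_on unit_cube. (\<lambda>m. u x * G m x $ i) \<longlonglongrightarrow> u x * f1 x"
      unfolding G_def f1_def by (intro AE_I2) (auto intro!: tendsto_intros limF limF' simp: space_restrict_space)
    show "AE x in lebesgue_on unit_cube. norm (u x * G m x $ i) \<le> C * \<bar>u x\<bar>" for m
    proof (rule AE_I2)
      fix x :: "real^'n" assume "x \<in> space (lebesgue_on unit_cube)"
      then have x: "x \<in> unit_cube" by simp
      have "\<bar>G m x $ i\<bar> \<le> C * 1"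
        unfolding G_def vec_lambda_beta abs_mult
        by (intro mult_mono F'1 x prodF) (auto simp: C_def)
      then show "norm (u x * G m x $ i) \<le> C * \<bar>u x\<bar>"
        using mult_right_mono[of "\<bar>G m x $ i\<bar>" C "\<bar>u x\<bar>"] by (simp add: abs_mult mult.commute)
    qed
    show "integrable (lebesgue_on unit_cube) (\<lambda>x. C * \<bar>u x\<bar>)" by (rule L1[OF u])
  qed (intro borel_measurable_times um cube_measurable_continuous contf1 contGi)+
  moreover have "(\<lambda>m. - L2_inner unit_cube (\<lambda>x. g x $ i) (\<eta> m)) \<longlonglongrightarrow> - L2_inner unit_cube (\<lambda>x. g x $ i) f0"
    unfolding L2_inner_def
  proof (intro tendsto_minus integral_dominated_convergence[where w = "\<lambda>x. 1 * \<bar>g x $ i\<bar>"])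
    show "AE x in lebesgue_on unit_cube. (\<lambda>m. g x $ i * \<eta> m x) \<longlonglongrightarrow> g x $ i * f0 x"
      unfolding \<eta>_def f0_def by (intro AE_I2) (auto intro!: tendsto_intros limF simp: space_restrict_space)
    show "AE x in lebesgue_on unit_cube. norm (g x $ i * \<eta> m x) \<le> 1 * \<bar>g x $ i\<bar>" for m
      using prodF by (intro AE_I2) (auto simp: \<eta>_def abs_mult mult_left_le space_restrict_space)
    show "integrable (lebesgue_on unit_cube) (\<lambda>x. 1 * \<bar>g x $ i\<bar>)" by (rule L1[OF g])
  qed (intro borel_measurable_times gm cube_measurable_continuous contf0 cont\<eta>)+
  ultimately have lim: "L2_inner unit_cube u f1 = - L2_inner unit_cube (\<lambda>x. g x $ i) f0"
    unfolding ibp using LIMSEQ_unique by blast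
  have "f1 x = (pi * k i) * cosine_product k x" for x
    unfolding f1_def cosine_product_def by (subst prod.remove[of UNIV i]) (auto simp: b_def b'_def)
  then have f1: "f1 = (\<lambda>x. (pi * k i) * cosine_product k x)" by auto
  have "cosine_gradient k x $ i = - (pi * k i) * f0 x" for x
    unfolding f0_def cosine_gradient_def by (subst prod.remove[of UNIV i]) (auto simp: b_def)
  then have f0: "(\<lambda>x. cosine_gradient k x $ i) = (\<lambda>x. - (pi * k i) * f0 x)" by auto
  have "L2_inner unit_cube u f1 = (pi * k i) * L2_inner unit_cube u (cosine_product k)"
    unfolding f1 by (rule L2_inner_scale_right)
  moreover have "L2_inner unit_cube (\<lambda>x. g x $ i) (\<lambda>x. cosine_gradient k x $ i) = - (pi * k i) * L2_inner unit_cube (\<lambda>x. g x $ i) f0"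
    unfolding f0 by (rule L2_inner_scale_right)
  moreover have "L2_inner unit_cube (\<lambda>x. g x $ i) f0 = - L2_inner unit_cube u f1"
    using lim by linarith
  ultimately show ?thesis by (simp only: power2_eq_square) simp
qed

text \<open>Summing the one-coordinate identity over all coordinates gives the weak eigenvalue
  equation against every H1 function, whatever its boundary behaviour: the Neumann condition in weak
  form.\<close>

lemma H1_cosine_weak_eigen:
  fixes u :: "real^'n \<Rightarrow> real"
  assumes H1: "H1_gradient unit_cube u g"
  shows "(\<integral>x. g x \<bullet> cosine_gradient k x \<partial>(lebesgue_on unit_cube))
    = cosine_eigenvalue k * L2_inner unit_cube u (cosine_product k)"
proof -
  have "L2_fun unit_cube (\<lambda>x. g x $ i)" for i using H1 by (auto simp: H1_gradient_def)
  moreover have "L2_fun unit_cube (\<lambda>x. cosine_gradient k x $ i)" for i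
    by (intro L2_fun_continuous continuous_intros continuous_on_cosine_gradient)
  ultimately have "(\<integral>x. g x \<bullet> cosine_gradient k x \<partial>(lebesgue_on unit_cube))
      = (\<Sum>i\<in>UNIV. L2_inner unit_cube (\<lambda>x. g x $ i) (\<lambda>x. cosine_gradient k x $ i))"
    unfolding inner_vec_def L2_inner_def by (simp add: L2_fun_integrable_mult)
  then show ?thesis
    by (simp add: H1_cosine_by_parts[OF H1] cosine_eigenvalue_def sum_distrib_right)
qed

text \<open>The Dirichlet form of \<open>\<phi> j\<close> and the cosine product is evaluated twice,
  once by the equation for \<open>\<phi> j\<close> and once by that for the cosine product.
  Different eigenvalues leave only a zero scalar product.\<close>

lemma cosine_product_in_eigenspace:
  fixes k :: "'n::finite \<Rightarrow> int"
  assumes "neumann_eigensystem (unit_cube :: (real^'n) set) ev \<phi>"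
  shows "in_eigenspace unit_cube ev \<phi> (cosine_eigenvalue k) (cosine_product k)"
  unfolding in_eigenspace_def
proof (intro conjI allI impI L2_fun_cosine_product)
  fix j assume ne: "ev j \<noteq> cosine_eigenvalue k"
  have "neumann_eigenfunction unit_cube (ev j) (\<phi> j)"
    using assms by (simp add: neumann_eigensystem_def)
  then obtain g where g: "H1_gradient unit_cube (\<phi> j) g"
    and eig: "\<And>v h. H1_gradient unit_cube v h \<Longrightarrow>
       (\<integral>x. g x \<bullet> h x \<partial>(lebesgue_on unit_cube)) = ev j * L2_inner unit_cube (\<phi> j) v"
    unfolding neumann_eigenfunction_def by (elim conjE exE) simp
  have "cosine_eigenvalue k * L2_inner unit_cube (\<phi> j) (cosine_product k)
      = ev j * L2_inner unit_cube (\<phi> j) (cosine_product k)"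
    using eig[OF H1_gradient_cosine_product, of k] H1_cosine_weak_eigen[OF g, of k] by simp
  then show "L2_inner unit_cube (cosine_product k) (\<phi> j) = 0"
    using ne by (simp add: L2_inner_commute)
qed

text \<open>Integration by parts in the single coordinate \<open>i\<close>, in both orders. Working
  per coordinate also separates products with the same total eigenvalue, such as those obtained by
  permuting coordinates.\<close>

lemma cosine_product_orthogonal:
  fixes k l :: "'n::finite \<Rightarrow> int"
  assumes "\<bar>k i\<bar> \<noteq> \<bar>l i\<bar>"
  shows "L2_inner unit_cube (cosine_product k) (cosine_product l) = 0"
proof -
  have "(pi * l i)\<^sup>2 * L2_inner unit_cube (cosine_product k) (cosine_product l)
      = (pi * k i)\<^sup>2 * L2_inner unit_cube (cosine_product k) (cosine_product l)"
    using H1_cosine_by_parts[OF H1_gradient_cosine_product, of k i l]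
      H1_cosine_by_parts[OF H1_gradient_cosine_product, of l i k]
    by (simp add: L2_inner_commute[of _ "cosine_product l"]
        L2_inner_commute[of _ "\<lambda>x. cosine_gradient l x $ i"])
  moreover have "(real_of_int (k i))\<^sup>2 \<noteq> (real_of_int (l i))\<^sup>2"
    using assms by (simp add: power2_eq_iff abs_eq_iff flip: of_int_minus)
  ultimately show ?thesis by (simp add: power_mult_distrib)
qed

lemma cosine_product_0: "cosine_product (\<lambda>_. 0) = (\<lambda>x. 1)"
  by (simp add: cosine_product_def fun_eq_iff)

lemma L2_inner_cube_const: "L2_inner (unit_cube :: (real^'n) set) (\<lambda>x. c) (\<lambda>x. d) = c * d"
  by (simp add: L2_inner_def measure_restrict_space measure_unit_cube)

section \<open>Completeness of the cosines and the first eigenvalue\<close>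

inductive_set cosine_span :: "(real^'n \<Rightarrow> real) set" where
  base: "cosine_product k \<in> cosine_span"
| add: "f \<in> cosine_span \<Longrightarrow> g \<in> cosine_span \<Longrightarrow> (\<lambda>x. f x + g x) \<in> cosine_span"
| scale: "f \<in> cosine_span \<Longrightarrow> (\<lambda>x. c * f x) \<in> cosine_span"

lemma cosine_span_continuous: "f \<in> cosine_span \<Longrightarrow> continuous_on S f"
  by (induction rule: cosine_span.induct) (auto intro!: continuous_intros continuous_on_cosine_product)

lemma cosine_product_upd:
  "cosine_product (k(i := c)) x = cos (pi * c * x $ i) * (\<Prod>j\<in>UNIV - {i}. cos (pi * k j * x $ j))"
  unfolding cosine_product_def by (subst prod.remove[of UNIV i]) auto

lemma cosine_product_mult_cos:
  "cosine_product k x * cos (pi * m * x $ i)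
    = 1/2 * cosine_product (k(i := k i + m)) x + 1/2 * cosine_product (k(i := k i - m)) x"
proof -
  have "cosine_product k x = cos (pi * k i * x $ i) * (\<Prod>j\<in>UNIV - {i}. cos (pi * k j * x $ j))"
    using cosine_product_upd[of k i "k i" x] by simp
  moreover have "cos (pi * k i * x $ i) * cos (pi * m * x $ i)
      = 1/2 * cos (pi * (k i + m) * x $ i) + 1/2 * cos (pi * (k i - m) * x $ i)"
    by (simp add: distrib_left distrib_right left_diff_distrib right_diff_distrib cos_add cos_diff)
  moreover have *: "p * b = t * r" if "p = a * r" "a * b = t" for p a r b t :: real
    using that by auto
  ultimately have "cosine_product k x * cos (pi * m * x $ i)
      = (1/2 * cos (pi * (k i + m) * x $ i) + 1/2 * cos (pi * (k i - m) * x $ i))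
        * (\<Prod>j\<in>UNIV - {i}. cos (pi * k j * x $ j))"
    using *[of "cosine_product k x"] by blast
  then show ?thesis
    unfolding cosine_product_upd by (simp add: distrib_right)
qed

text \<open>Induction on a set \<open>A\<close> containing the support of \<open>l\<close>: each
  step moves one cosine factor of \<open>l\<close> into the first product, which splits into two
  products with shifted frequencies. The induction therefore has to hold for all
  \<open>k\<close>.\<close>

lemma cosine_product_mult_cosine_product:
  fixes k l :: "'n::finite \<Rightarrow> int"
  assumes "finite A" "\<And>j. j \<notin> A \<Longrightarrow> l j = 0"
  shows "(\<lambda>x. cosine_product k x * cosine_product l x) \<in> cosine_span"
  using assms
proof (induction A arbitrary: k l)
  case empty
  then have "l = (\<lambda>_. 0)" by auto
  then show ?case by (simp add: cosine_product_0 cosine_span.base)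
next
  case (insert i A)
  let ?l = "l(i := 0)"
  have "cosine_product l x = cos (pi * l i * x $ i) * cosine_product ?l x" for x
    using cosine_product_upd[of l i "l i" x] cosine_product_upd[of l i 0 x] by simp
  then have "cosine_product k x * cosine_product l x = (cosine_product k x * cos (pi * l i * x $ i)) * cosine_product ?l x" for x
    by simp
  also have "\<dots> x = 1/2 * (cosine_product (k(i := k i + l i)) x * cosine_product ?l x)
      + 1/2 * (cosine_product (k(i := k i - l i)) x * cosine_product ?l x)" for x
    unfolding cosine_product_mult_cos by (simp add: distrib_right mult.assoc)
  finally have "(\<lambda>x. cosine_product k x * cosine_product l x) =
     (\<lambda>x. 1/2 * (cosine_product (k(i := k i + l i)) x * cosine_product ?l x)
      + 1/2 * (cosine_product (k(i := k i - l i)) x * cosine_product ?l x))" by (rule ext)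
  also have "\<dots> \<in> cosine_span"
    by (intro cosine_span.add cosine_span.scale insert.IH) (use insert.prems in auto)
  finally show ?case .
qed

lemma cosine_span_mult:
  assumes "f \<in> cosine_span" "g \<in> cosine_span"
  shows "(\<lambda>x. f x * g x) \<in> cosine_span"
  using assms(1)
proof (induction rule: cosine_span.induct)
  case (base k)
  show ?case
    using assms(2)
  proof (induction rule: cosine_span.induct)
    case (base l)
    show ?case by (rule cosine_product_mult_cosine_product[OF finite_class.finite_UNIV]) auto
  next
    case (add f g)
    then show ?case using cosine_span.add[OF add.IH] by (simp add: distrib_left)
  next
    case (scale f c)
    then show ?case using cosine_span.scale[OF scale.IH, of c] by (simp add: mult.left_commute)
  qed
next
  case (add f g)
  then show ?case using cosine_span.add[OF add.IH] by (simp add: distrib_right)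
next
  case (scale f c)
  then show ?case using cosine_span.scale[OF scale.IH, of c] by (simp add: mult.assoc)
qed

lemma cosine_product_single: "cosine_product ((\<lambda>_. 0)(i := m)) x = cos (pi * m * x $ i)"
  by (simp add: cosine_product_upd)

text \<open>Stone-Weierstrass: the span is an algebra by the product-to-sum formula, it contains the
  constants as frequency zero, and it separates points of the closed cube because cosine is
  injective on the interval from 0 to \<pi>.\<close>

lemma cosine_span_dense:
  fixes f :: "real^'n \<Rightarrow> real"
  assumes "continuous_on UNIV f" "e > 0"
  obtains h where "h \<in> cosine_span" "\<And>x. x \<in> cbox 0 1 \<Longrightarrow> \<bar>f x - h x\<bar> < e"
proof -
  have "\<exists>h. h \<in> cosine_span \<and> (\<forall>x \<in> cbox 0 1. \<bar>f x - h x\<bar> < e)"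
  proof (rule Stone_Weierstrass_HOL)
    show "(\<lambda>x. c) \<in> cosine_span" for c
      using cosine_span.scale[OF cosine_span.base, of c "\<lambda>_. 0"] by (simp add: cosine_product_0)
    show "\<exists>h. h \<in> cosine_span \<and> h x \<noteq> h y" if xy: "x \<in> cbox 0 1 \<and> y \<in> cbox 0 1 \<and> x \<noteq> y" for x y :: "real^'n"
    proof -
      obtain i where i: "x $ i \<noteq> y $ i" using xy by (metis vec_eq_iff)
      have "0 \<le> x $ i" "x $ i \<le> 1" "0 \<le> y $ i" "y $ i \<le> 1" using xy by (auto simp: mem_box_cart)
      then have "cos (pi * x $ i) \<noteq> cos (pi * y $ i)"
        using cos_inj_pi[of "pi * x $ i" "pi * y $ i"] i by (auto simp: mult_left_le)
      then have "cosine_product ((\<lambda>_. 0)(i := 1)) x \<noteq> cosine_product ((\<lambda>_. 0)(i := 1)) y"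
        by (simp add: cosine_product_single)
      then show ?thesis using cosine_span.base by blast
    qed
  qed (use assms cosine_span_mult in \<open>auto intro: cosine_span_continuous cosine_span.add continuous_on_subset\<close>)
  then show ?thesis using that by auto
qed

text \<open>The ideal test function is \<open>u\<close> clamped to the interval from -1 to 1: its
  product with \<open>u\<close> is nonnegative and vanishes only where \<open>u\<close> does. It is
  an almost everywhere limit of continuous functions; clamping these as well keeps the limit, since
  clamping is continuous and idempotent, and makes \<open>\<bar>u\<bar>\<close> a majorant.\<close>

lemma orthogonal_to_continuous_imp_AE_0:
  fixes u :: "real^'n \<Rightarrow> real"
  assumes S: "S \<in> sets lebesgue" and int: "integrable (lebesgue_on S) u"
    and orth: "\<And>f B. continuous_on UNIV f \<Longrightarrow> (\<And>x. \<bar>f x\<bar> \<le> B) \<Longrightarrow> (\<integral>x. u x * f x \<partial>(lebesgue_on S)) = 0"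
  shows "AE x in lebesgue_on S. u x = 0"
proof -
  define cl where "cl t = max (-1) (min 1 t)" for t :: real
  have cl: "\<bar>cl t\<bar> \<le> 1" "t * cl t = 0 \<longleftrightarrow> t = 0" "0 \<le> t * cl t" for t
    by (auto simp: cl_def max_def min_def mult_nonpos_nonpos)
  have clcl: "cl (cl t) = cl t" for t by (auto simp: cl_def max_def min_def)
  have [measurable]: "u \<in> borel_measurable (lebesgue_on S)" using int by auto
  have clm: "(\<lambda>x. cl (u x)) \<in> borel_measurable (lebesgue_on S)" unfolding cl_def by measurable
  then have "(\<lambda>x. cl (u x)) measurable_on S" using S by (simp add: measurable_on_iff_borel_measurable)
  then obtain N g where N: "negligible N" and cont: "\<And>n. continuous_on UNIV (g n)"
    and lim: "\<And>x. x \<notin> N \<Longrightarrow> (\<lambda>n. g n x) \<longlonglongrightarrow> (if x \<in> S then cl (u x) else 0)"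
    unfolding measurable_on_def by blast
  define h where "h n x = cl (g n x)" for n x
  have conth: "continuous_on UNIV (h n)" for n
    unfolding h_def[abs_def] cl_def by (intro continuous_intros cont)
  have "(\<lambda>n. \<integral>x. u x * h n x \<partial>(lebesgue_on S)) \<longlonglongrightarrow> (\<integral>x. u x * cl (u x) \<partial>(lebesgue_on S))"
  proof (rule integral_dominated_convergence[where w = "\<lambda>x. \<bar>u x\<bar>"])
    have "AE x in lebesgue. x \<notin> N" using N by (intro AE_not_in) (simp add: negligible_iff_null_sets)
    then have "AE x in lebesgue_on S. x \<notin> N" using S by (subst AE_restrict_space_iff) auto
    moreover have "AE x in lebesgue_on S. x \<in> S" using S by (subst AE_restrict_space_iff) auto
    ultimately show "AE x in lebesgue_on S. (\<lambda>n. u x * h n x) \<longlonglongrightarrow> u x * cl (u x)"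
    proof eventually_elim
      case (elim x)
      then have "(\<lambda>n. g n x) \<longlonglongrightarrow> cl (u x)" using lim[of x] by simp
      then have "(\<lambda>n. cl (g n x)) \<longlonglongrightarrow> cl (cl (u x))" unfolding cl_def by (intro tendsto_intros)
      then show ?case unfolding h_def clcl by (intro tendsto_intros)
    qed
    show "AE x in lebesgue_on S. norm (u x * h n x) \<le> \<bar>u x\<bar>" for n
      using cl(1) by (intro AE_I2) (simp add: h_def abs_mult mult_left_le)
    show "(\<lambda>x. u x * h n x) \<in> borel_measurable (lebesgue_on S)" for n
    proof (rule borel_measurable_times)
      show "h n \<in> borel_measurable (lebesgue_on S)"
        using S conth by (intro continuous_imp_measurable_on_sets_lebesgue continuous_on_subset[OF conth]) auto
    qed measurable
  qed (use int clm in auto)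
  moreover have "(\<integral>x. u x * h n x \<partial>(lebesgue_on S)) = 0" for n
    by (rule orth[OF conth, of _ 1]) (simp add: h_def cl)
  ultimately have "(\<integral>x. u x * cl (u x) \<partial>(lebesgue_on S)) = 0"
    by (simp add: LIMSEQ_const_iff)
  moreover have "integrable (lebesgue_on S) (\<lambda>x. u x * cl (u x))"
  proof (rule Bochner_Integration.integrable_bound[OF int])
    show "AE x in lebesgue_on S. norm (u x * cl (u x)) \<le> norm (u x)"
      using cl(1) by (intro AE_I2) (simp add: abs_mult mult_left_le)
  qed (use clm in auto)
  ultimately have "AE x in lebesgue_on S. u x * cl (u x) = 0"
    by (subst (asm) integral_nonneg_eq_0_iff_AE) (auto simp: cl)
  then show ?thesis by (simp only: cl)
qed

lemma cosine_products_complete: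
  fixes u :: "real^'n \<Rightarrow> real"
  assumes u: "L2_fun unit_cube u" and orth: "\<And>k. L2_inner unit_cube u (cosine_product k) = 0"
  shows "AE x in lebesgue_on unit_cube. u x = 0"
proof (rule orthogonal_to_continuous_imp_AE_0)
  show int: "integrable (lebesgue_on unit_cube) u"
    using L2_fun_integrable_mult[OF u L2_fun_continuous[of "\<lambda>x. 1"]] by simp
  have span: "L2_inner unit_cube u h = 0" if "h \<in> cosine_span" for h
    using that
  proof (induction rule: cosine_span.induct)
    case (add f g)
    then show ?case
      by (simp add: L2_inner_add_right u L2_fun_continuous cosine_span_continuous)
  qed (auto simp: orth L2_inner_scale_right)
  fix f :: "real^'n \<Rightarrow> real" assume f: "continuous_on UNIV f"
  define I where "I = (\<integral>x. \<bar>u x\<bar> \<partial>(lebesgue_on unit_cube))"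
  have "\<bar>L2_inner unit_cube u f\<bar> \<le> 0"
  proof (rule field_le_epsilon)
    fix e :: real assume "e > 0"
    have "I \<ge> 0" unfolding I_def by simp
    \<comment> \<open>The added 1 keeps the denominator positive when \<open>I = 0\<close>.\<close>
    define d where "d = e / (I + 1)"
    have "d > 0" using \<open>e > 0\<close> \<open>I \<ge> 0\<close> by (simp add: d_def)
    then obtain h where h: "h \<in> cosine_span" and fh: "\<And>x. x \<in> cbox 0 1 \<Longrightarrow> \<bar>f x - h x\<bar> < d"
      using cosine_span_dense[OF f] by blast
    have hL: "L2_fun unit_cube h" by (intro L2_fun_continuous cosine_span_continuous h)
    have "L2_inner unit_cube u f = L2_inner unit_cube u (\<lambda>x. f x - h x)"
      using span[OF h] by (simp add: L2_inner_diff_right u hL L2_fun_continuous f)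
    also have "\<bar>\<dots>\<bar> \<le> (\<integral>x. \<bar>u x * (f x - h x)\<bar> \<partial>(lebesgue_on unit_cube))"
      unfolding L2_inner_def by (rule integral_abs_bound)
    also have "\<dots> \<le> (\<integral>x. d * \<bar>u x\<bar> \<partial>(lebesgue_on unit_cube))"
    proof (rule integral_mono)
      show "integrable (lebesgue_on unit_cube) (\<lambda>x. \<bar>u x * (f x - h x)\<bar>)"
        by (intro integrable_abs L2_fun_integrable_mult u L2_fun_diff hL L2_fun_continuous f)
      fix x :: "real^'n" assume "x \<in> space (lebesgue_on unit_cube)"
      then have "x \<in> cbox 0 1" using box_subset_cbox by (auto simp: unit_cube_eq_box)
      then show "\<bar>u x * (f x - h x)\<bar> \<le> d * \<bar>u x\<bar>"
        using fh[of x] mult_right_mono[of "\<bar>f x - h x\<bar>" d "\<bar>u x\<bar>"] by (simp add: abs_mult mult.commute)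
    qed (use int in auto)
    also have "\<dots> = d * I" by (simp add: I_def)
    also have "\<dots> \<le> e" using \<open>e > 0\<close> \<open>I \<ge> 0\<close> by (simp add: d_def field_simps)
    finally show "\<bar>L2_inner unit_cube u f\<bar> \<le> 0 + e" by simp
  qed
  then show "(\<integral>x. u x * f x \<partial>(lebesgue_on unit_cube)) = 0" by (simp add: L2_inner_def)
qed simp

text \<open>Each active coordinate halves the squared norm: the squared cosine is 1/2 plus half the
  cosine of doubled frequency, and the latter part is orthogonal by the frequencies
  \<open>2 * k i\<close> and 0 in coordinate \<open>i\<close>.\<close>

lemma L2_norm_cosine_product:
  fixes k :: "'n::finite \<Rightarrow> int"
  assumes "k i \<noteq> 0"
  shows "L2_inner unit_cube (cosine_product k) (cosine_product k)
    = 1/2 * L2_inner unit_cube (cosine_product (k(i := 0))) (cosine_product (k(i := 0)))"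
proof -
  let ?k = "k(i := 0)"
  have "cosine_product k x * cosine_product k x = 1/2 * (cosine_product ?k x * cosine_product ?k x)
      + 1/2 * (cosine_product (?k(i := 2 * k i)) x * cosine_product ?k x)" for x
  proof -
    have k: "cosine_product k x = cos (pi * k i * x $ i) * cosine_product ?k x"
      using cosine_product_upd[of k i "k i" x] cosine_product_upd[of k i 0 x] by simp
    have k2: "cosine_product (?k(i := 2 * k i)) x = cos (2 * (pi * k i * x $ i)) * cosine_product ?k x"
      using cosine_product_upd[of k i "2 * k i" x] cosine_product_upd[of k i 0 x] by (simp add: mult_ac)
    show ?thesis unfolding k k2 cos_double_cos by (simp add: algebra_simps power2_eq_square)
  qed
  moreover have "L2_inner unit_cube (cosine_product (?k(i := 2 * k i))) (cosine_product ?k) = 0"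
    by (rule cosine_product_orthogonal[of _ i]) (use assms in auto)
  moreover have "integrable (lebesgue_on unit_cube) (\<lambda>x. cosine_product k x * cosine_product l x)" for k l :: "'n \<Rightarrow> int"
    by (intro L2_fun_integrable_mult L2_fun_cosine_product)
  ultimately show ?thesis
    by (simp add: L2_inner_def)
qed

lemma L2_norm_cosine_single:
  assumes "m \<noteq> 0"
  shows "L2_inner unit_cube (cosine_product ((\<lambda>_. 0)(i := m))) (cosine_product ((\<lambda>_. 0)(i := m))) = 1/2"
  using assms by (subst L2_norm_cosine_product[of _ i])
    (auto simp: cosine_product_0 L2_inner_cube_const fun_upd_idem)

lemma L2_norm_cosine_pair:
  assumes "m \<noteq> 0" "l \<noteq> 0" "i \<noteq> j"
  shows "L2_inner unit_cube (cosine_product ((\<lambda>_. 0)(i := m, j := l))) (cosine_product ((\<lambda>_. 0)(i := m, j := l))) = 1/4"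
  using assms by (subst L2_norm_cosine_product[of _ j])
    (auto simp: L2_norm_cosine_single fun_upd_idem)

lemma cosine_eigenvalue_single: "cosine_eigenvalue ((\<lambda>_. 0)(i := m)) = (pi * m)\<^sup>2"
  unfolding cosine_eigenvalue_def by (subst sum.remove[of UNIV i]) auto

lemma cosine_eigenvalue_pair:
  "i \<noteq> j \<Longrightarrow> cosine_eigenvalue ((\<lambda>_. 0)(i := m, j := l)) = (pi * m)\<^sup>2 + (pi * l)\<^sup>2"
  unfolding cosine_eigenvalue_def
  by (subst sum.remove[of UNIV i], simp, simp, subst sum.remove[of "UNIV - {i}" j]) auto

text \<open>A single cosine is a nonzero element of the eigenspace of \<pi>^2, so by Parseval this
  value occurs in \<open>ev\<close>, at a positive index. Conversely, an \<open>ev 1\<close>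
  strictly between 0 and \<pi>^2 differs from every cosine eigenvalue; then \<open>\<phi> 1\<close>
  is orthogonal to all cosine products and vanishes by completeness.\<close>

lemma first_neumann_eigenvalue:
  assumes sys: "neumann_eigensystem (unit_cube :: (real^'n) set) ev \<phi>"
  shows "ev 1 = pi\<^sup>2"
proof (rule antisym)
  have basis: "L2_orthonormal_basis unit_cube \<phi>" and ev: "ev 0 = 0" "0 < ev 1" "mono ev"
    and eig: "neumann_eigenfunction unit_cube (ev j) (\<phi> j)" for j
    using sys by (auto simp: neumann_eigensystem_def)
  \<comment> \<open>Here \<open>undefined\<close> merely stands for some coordinate; any index would
    serve.\<close>
  define f :: "real^'n \<Rightarrow> real" where "f = cosine_product ((\<lambda>_. 0)(undefined := 1))"
  have f: "in_eigenspace unit_cube ev \<phi> (pi\<^sup>2) f"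
    using cosine_product_in_eigenspace[OF sys, of "(\<lambda>_. 0)(undefined := 1)"]
    by (simp add: f_def cosine_eigenvalue_single)
  have "\<exists>j. L2_inner unit_cube f (\<phi> j) \<noteq> 0"
  proof (rule ccontr)
    assume "\<not> ?thesis"
    then have "(\<lambda>j. 0) sums L2_inner unit_cube f f"
      using L2_basis_sums[OF basis, of f] f by (simp add: in_eigenspace_def)
    then have "L2_inner unit_cube f f = 0" by (simp add: sums_unique2)
    then show False by (simp add: f_def L2_norm_cosine_single)
  qed
  then obtain j where j: "ev j = pi\<^sup>2" using f by (auto simp: in_eigenspace_def)
  then have "j \<noteq> 0" using ev(1) by (intro notI) simp
  then show "ev 1 \<le> pi\<^sup>2" using monoD[OF ev(3), of 1 j] j by simp
  show "pi\<^sup>2 \<le> ev 1"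
  proof (rule ccontr)
    assume less: "\<not> ?thesis"
    have "L2_inner unit_cube (\<phi> 1) (cosine_product k) = 0" for k
    proof -
      have "ev 1 \<noteq> cosine_eigenvalue k"
      proof (cases "k = (\<lambda>_. 0)")
        case True
        then show ?thesis using ev by (simp add: cosine_eigenvalue_def)
      next
        case False
        then obtain i where "k i \<noteq> 0" by auto
        then have "(1::real) \<le> \<bar>real_of_int (k i)\<bar>" by linarith
        then have "1 \<le> (real_of_int (k i))\<^sup>2" by (metis abs_le_square_iff abs_one one_power2)
        then have "pi\<^sup>2 * 1 \<le> (pi * k i)\<^sup>2"
          unfolding power_mult_distrib by (intro mult_left_mono) auto
        also have "\<dots> \<le> cosine_eigenvalue k"
          unfolding cosine_eigenvalue_def by (rule member_le_sum) auto
        finally show ?thesis using less by simp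
      qed
      then show ?thesis
        using cosine_product_in_eigenspace[OF sys, of k] by (auto simp: in_eigenspace_def L2_inner_commute)
    qed
    then have "AE x in lebesgue_on unit_cube. \<phi> 1 x = 0"
      using basis by (intro cosine_products_complete) (auto simp: L2_orthonormal_basis_def)
    then show False using eig[of 1] by (simp add: neumann_eigenfunction_def nonzero_on_def)
  qed
qed

section \<open>The directions S, D, P: eigenspaces, the square of S, and norms\<close>

definition cos_sum :: "real^'n \<Rightarrow> real" where
  "cos_sum x = (\<Sum>i\<in>UNIV. cos (pi * x $ i))"

definition cos2_sum :: "real^'n \<Rightarrow> real" where
  "cos2_sum x = (\<Sum>i\<in>UNIV. cos (2 * pi * x $ i))"

text \<open>Ordered pairs, so every unordered product is counted twice; this is what lets the square
  of \<open>cos_sum\<close> contain it with coefficient 1. It is the zero function in dimension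
  one.\<close>

definition cos_pair_sum :: "real^'n \<Rightarrow> real" where
  "cos_pair_sum x = (\<Sum>p | fst p \<noteq> snd p. cos (pi * x $ fst p) * cos (pi * x $ snd p))"

lemma cos_sum_eq: "cos_sum = (\<lambda>x. \<Sum>i\<in>UNIV. cosine_product ((\<lambda>_. 0)(i := 1)) x)"
  by (simp add: cos_sum_def fun_eq_iff cosine_product_single)

lemma cos2_sum_eq: "cos2_sum = (\<lambda>x. \<Sum>i\<in>UNIV. cosine_product ((\<lambda>_. 0)(i := 2)) x)"
  by (simp add: cos2_sum_def fun_eq_iff cosine_product_single mult_ac)

lemma cos_pair_sum_eq:
  "(cos_pair_sum :: real^'n \<Rightarrow> real) = (\<lambda>x. \<Sum>p | fst p \<noteq> snd p. cosine_product ((\<lambda>_. 0)(fst p := 1, snd p := 1)) x)"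
proof -
  have "cosine_product ((\<lambda>_. 0)(i := 1, j := 1)) x = cos (pi * x $ i) * cos (pi * x $ j)"
    if "i \<noteq> j" for i j and x :: "real^'n"
    using that unfolding cosine_product_upd
    by (subst prod.remove[of "UNIV - {j}" i]) auto
  then show ?thesis by (auto simp: cos_pair_sum_def fun_eq_iff intro!: sum.cong)
qed

lemma continuous_on_cos_sums [continuous_intros]:
  "continuous_on S cos_sum" "continuous_on S cos2_sum" "continuous_on S cos_pair_sum"
  unfolding cos_sum_eq cos2_sum_eq cos_pair_sum_eq
  by (intro continuous_intros continuous_on_cosine_product)+

lemma cos_sum_in_eigenspace:
  assumes sys: "neumann_eigensystem (unit_cube :: (real^'n) set) ev \<phi>"
  shows "in_eigenspace unit_cube ev \<phi> (pi\<^sup>2) cos_sum"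
    and "in_eigenspace unit_cube ev \<phi> (4 * pi\<^sup>2) cos2_sum"
    and "in_eigenspace unit_cube ev \<phi> (2 * pi\<^sup>2) cos_pair_sum"
    and "in_eigenspace unit_cube ev \<phi> 0 (\<lambda>x. 1)"
proof -
  have basis: "L2_orthonormal_basis unit_cube \<phi>" using sys by (simp add: neumann_eigensystem_def)
  show "in_eigenspace unit_cube ev \<phi> (pi\<^sup>2) cos_sum"
    unfolding cos_sum_eq
  proof (intro in_eigenspace_sum basis)
    fix i
    show "in_eigenspace unit_cube ev \<phi> (pi\<^sup>2) (cosine_product ((\<lambda>_. 0)(i := 1)))"
      using cosine_product_in_eigenspace[OF sys, of "(\<lambda>_. 0)(i := 1)"]
      by (simp add: cosine_eigenvalue_single)
  qed
  show "in_eigenspace unit_cube ev \<phi> (4 * pi\<^sup>2) cos2_sum"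
    unfolding cos2_sum_eq
  proof (intro in_eigenspace_sum basis)
    fix i
    show "in_eigenspace unit_cube ev \<phi> (4 * pi\<^sup>2) (cosine_product ((\<lambda>_. 0)(i := 2)))"
      using cosine_product_in_eigenspace[OF sys, of "(\<lambda>_. 0)(i := 2)"]
      by (simp add: cosine_eigenvalue_single power_mult_distrib mult.commute)
  qed
  show "in_eigenspace unit_cube ev \<phi> (2 * pi\<^sup>2) cos_pair_sum"
    unfolding cos_pair_sum_eq
  proof (intro in_eigenspace_sum basis)
    fix p :: "'n \<times> 'n" assume "p \<in> {p. fst p \<noteq> snd p}"
    then show "in_eigenspace unit_cube ev \<phi> (2 * pi\<^sup>2) (cosine_product ((\<lambda>_. 0)(fst p := 1, snd p := 1)))"
      using cosine_product_in_eigenspace[OF sys, of "(\<lambda>_. 0)(fst p := 1, snd p := 1)"]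
      by (simp add: cosine_eigenvalue_pair)
  qed
  show "in_eigenspace unit_cube ev \<phi> 0 (\<lambda>x. 1)"
    using cosine_product_in_eigenspace[OF sys, of "\<lambda>_. 0"]
    by (simp add: cosine_product_0 cosine_eigenvalue_def)
qed

lemma cos_sum_square:
  fixes x :: "real^'n"
  shows "(cos_sum x)\<^sup>2 = real CARD('n) / 2 + cos2_sum x / 2 + cos_pair_sum x"
proof -
  define c where "c i = cos (pi * x $ i)" for i
  have "(cos_sum x)\<^sup>2 = (\<Sum>p\<in>UNIV \<times> UNIV. c (fst p) * c (snd p))"
    unfolding cos_sum_def power2_eq_square sum_product sum.cartesian_product by (simp add: c_def case_prod_beta)
  also have "UNIV \<times> UNIV = {p :: 'n \<times> 'n. fst p = snd p} \<union> {p. fst p \<noteq> snd p}" by auto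
  also have "(\<Sum>p\<in>\<dots>. c (fst p) * c (snd p)) =
      (\<Sum>p | fst p = snd p. c (fst p) * c (snd p)) + (\<Sum>p | fst p \<noteq> snd p. c (fst p) * c (snd p))"
    by (rule sum.union_disjoint) auto
  also have "(\<Sum>p | fst p = snd p. c (fst p) * c (snd p)) = (\<Sum>i\<in>UNIV. c i * c i)"
    by (rule sum.reindex_bij_witness[of _ "\<lambda>i. (i, i)" fst]) auto
  also have "(\<lambda>i. c i * c i) = (\<lambda>i. 1 / 2 + cos (2 * pi * x $ i) / 2)"
    using cos_double_cos[of "pi * x $ _"] by (simp add: fun_eq_iff c_def power2_eq_square mult.assoc diff_divide_distrib)
  finally show ?thesis
    by (simp add: cos2_sum_def cos_pair_sum_def c_def sum.distrib sum_divide_distrib)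
qed

lemma L2_norm_cos2_sum: "L2_inner unit_cube cos2_sum (cos2_sum :: real^'n \<Rightarrow> real) = real CARD('n) / 2"
proof -
  let ?p = "\<lambda>i::'n. cosine_product ((\<lambda>_. 0)(i := 2))"
  have "L2_inner unit_cube cos2_sum (cos2_sum :: real^'n \<Rightarrow> real)
      = (\<Sum>i\<in>UNIV. \<Sum>j\<in>UNIV. L2_inner unit_cube (?p i) (?p j))"
    unfolding cos2_sum_eq
    by (simp add: L2_inner_sum_left L2_inner_sum_right L2_fun_cosine_product L2_fun_sum)
  also have "\<dots> = (\<Sum>i\<in>(UNIV::'n set). \<Sum>j\<in>UNIV. if j = i then 1/2 else 0)"
  proof (intro sum.cong refl)
    fix i j :: 'n
    show "L2_inner unit_cube (?p i) (?p j) = (if j = i then 1/2 else 0)"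
      by (cases "i = j") (auto simp: L2_norm_cosine_single intro!: cosine_product_orthogonal[of _ i])
  qed
  also have "\<dots> = real CARD('n) / 2" by simp
  finally show ?thesis .
qed

text \<open>A pair is orthogonal to all pairs except itself and its transpose, which carry the same
  function of squared norm 1/4. Each of the n (n - 1) ordered pairs thus contributes 1/2.\<close>

lemma L2_norm_cos_pair_sum:
  "L2_inner unit_cube cos_pair_sum (cos_pair_sum :: real^'n \<Rightarrow> real) = real CARD('n) * (real CARD('n) - 1) / 2"
proof -
  let ?A = "{p :: 'n \<times> 'n. fst p \<noteq> snd p}"
  let ?p = "\<lambda>p::'n\<times>'n. cosine_product ((\<lambda>_. 0)(fst p := 1, snd p := 1))"
  have "L2_inner unit_cube cos_pair_sum (cos_pair_sum :: real^'n \<Rightarrow> real)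
      = (\<Sum>p\<in>?A. \<Sum>r\<in>?A. L2_inner unit_cube (?p p) (?p r))"
    unfolding cos_pair_sum_eq
    by (simp add: L2_inner_sum_left L2_inner_sum_right L2_fun_cosine_product L2_fun_sum)
  also have "\<dots> = (\<Sum>p\<in>?A. 1/2)"
  proof (rule sum.cong[OF refl])
    fix p assume p: "p \<in> ?A"
    define i j where ij: "i = fst p" "j = snd p"
    have ne: "i \<noteq> j" using p ij by auto
    have "(\<Sum>r\<in>?A. L2_inner unit_cube (?p p) (?p r)) = (\<Sum>r\<in>{(i, j), (j, i)}. L2_inner unit_cube (?p p) (?p r))"
    proof (rule sum.mono_neutral_right)
      show "\<forall>r\<in>?A - {(i, j), (j, i)}. L2_inner unit_cube (?p p) (?p r) = 0"
      proof
        fix r assume r: "r \<in> ?A - {(i, j), (j, i)}"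
        then have "i \<notin> {fst r, snd r} \<or> j \<notin> {fst r, snd r}" using ne by (cases r) auto
        then show "L2_inner unit_cube (?p p) (?p r) = 0"
        proof
          assume "i \<notin> {fst r, snd r}"
          then show ?thesis by (intro cosine_product_orthogonal[of _ i]) (use ij in auto)
        next
          assume "j \<notin> {fst r, snd r}"
          then show ?thesis by (intro cosine_product_orthogonal[of _ j]) (use ij in auto)
        qed
      qed
    qed (use ne in auto)
    also have "\<dots> = L2_inner unit_cube (?p p) (?p p) + L2_inner unit_cube (?p p) (?p p)"
    proof -
      have "?p (i, j) = ?p p" using ij by simp
      moreover have "?p (j, i) = ?p p" using ij ne by (simp add: fun_upd_twist)
      ultimately show ?thesis using ne by simp
    qed
    also have "\<dots> = 1/2" using p by (simp add: L2_norm_cosine_pair)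
    finally show "(\<Sum>r\<in>?A. L2_inner unit_cube (?p p) (?p r)) = 1/2" .
  qed
  also have "\<dots> = real (card ?A) / 2" by simp
  also have "card ?A = CARD('n) * CARD('n) - CARD('n)"
  proof -
    have "?A = UNIV - range (\<lambda>i. (i, i))" by auto
    then have "card ?A = card (UNIV :: ('n \<times> 'n) set) - card (range (\<lambda>i::'n. (i, i)))"
      by (simp add: card_Diff_subset)
    moreover have "card (range (\<lambda>i::'n. (i, i))) = CARD('n)" by (rule card_image) (auto intro: injI)
    ultimately show ?thesis by (simp add: card_cartesian_product flip: UNIV_Times_UNIV)
  qed
  finally show ?thesis by (simp add: algebra_simps)
qed

section \<open>Lipschitz functions in the Sobolev--Slobodetskii space\<close>

text \<open>Take the least exponent for which the dyadic radius drops below \<open>d\<close>. It is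
  positive since \<open>d \<le> R\<close>, and its predecessor is the required index.\<close>

lemma dyadic_scale:
  fixes d R :: real
  assumes "0 < d" "d \<le> R"
  obtains k :: nat where "R / 2 ^ Suc k < d" "d \<le> R / 2 ^ k"
proof -
  have R: "R > 0" using assms by linarith
  have "\<exists>k. R / 2 ^ k < d"
  proof -
    obtain k where "inverse (2 ^ k) < d / R"
      using real_arch_pow_inv[of "d / R" "1/2"] assms R by (auto simp: power_one_over inverse_eq_divide)
    then have "R / 2 ^ k < d" using R by (simp add: field_simps)
    then show ?thesis ..
  qed
  then have K: "R / 2 ^ (LEAST k. R / 2 ^ k < d) < d" by (rule LeastI_ex)
  moreover obtain k where k: "(LEAST k. R / 2 ^ k < d) = Suc k"
    using K assms by (cases "LEAST k. R / 2 ^ k < d") auto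
  moreover have "\<not> R / 2 ^ k < d" using not_less_Least[of k "\<lambda>k. R / 2 ^ k < d"] k by simp
  ultimately show ?thesis using that[of k] by simp
qed

text \<open>The kernel is split over the dyadic shells around \<open>x\<close>: the shell of radius \<open>r\<close> contributes
  \<open>O(r\<^sup>2 r\<^sup>n / r\<^bsup>n + 2s\<^esup>)\<close>, which is summable.\<close>

lemma lipschitz_in_slobodetskii_space:
  fixes u :: "real^'n \<Rightarrow> real"
  assumes s: "0 < s" "s < 1" and \<Omega>: "\<Omega> \<in> sets lebesgue" "bounded \<Omega>"
    and u: "L2_fun \<Omega> u" and lip: "L-lipschitz_on \<Omega> u"
  shows "u \<in> slobodetskii_space \<Omega> s"
proof -
  define n where "n = CARD('n)"
  define a where "a = real n + 2 * s"
  have a: "a > 0" using s by (simp add: a_def add_nonneg_pos)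
  obtain R0 where R0: "\<And>x y. x \<in> \<Omega> \<Longrightarrow> y \<in> \<Omega> \<Longrightarrow> dist x y \<le> R0"
    using \<Omega>(2) unfolding bounded_two_points by auto
  define R where "R = max R0 1"
  have R: "R > 0" "\<And>x y. x \<in> \<Omega> \<Longrightarrow> y \<in> \<Omega> \<Longrightarrow> norm (x - y) \<le> R"
    using R0 by (auto simp: R_def dist_norm intro: le_max_iff_disj[THEN iffD2])
  define r where "r k = R / 2 ^ k" for k :: nat
  have r: "r k > 0" for k using R by (simp add: r_def)
  have L: "L \<ge> 0" using lip by (rule lipschitz_on_nonneg)
  \<comment> \<open>On the shell between \<open>r (Suc k)\<close> and \<open>r k\<close> the
    Lipschitz bound uses the outer radius and the singular denominator the inner one.\<close>
  define C where "C k = (L * r k)\<^sup>2 / r (Suc k) powr a" for k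
  have C: "C k \<ge> 0" for k by (simp add: C_def)
  define V where "V = unit_ball_vol (real n)"
  have V: "V \<ge> 0" by (simp add: V_def)
  define K where "K k = C k * (V * r k ^ n)" for k
  have K: "K k \<ge> 0" for k using C V r[of k] by (simp add: K_def)
  \<comment> \<open>The dimension cancels: the ball volume compensates the exponent n of the kernel,
    leaving a geometric series whose ratio is below 1 because \<open>s < 1\<close>.\<close>
  have Keq: "K k = (L\<^sup>2 * V * 2 powr a * R powr (2 - 2 * s)) * (2 powr (2 * s - 2)) ^ k" for k
  proof -
    have "r (Suc k) = r k / 2" by (simp add: r_def)
    then have "r (Suc k) powr a = r k powr a / 2 powr a" using r[of k] by (simp only: powr_divide)
    then have "K k = L\<^sup>2 * V * 2 powr a * ((r k)\<^sup>2 * r k ^ n / r k powr a)"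
      by (simp add: K_def C_def power_mult_distrib)
    also have "(r k)\<^sup>2 * r k ^ n / r k powr a = r k powr (2 - 2 * s)"
    proof -
      have "(r k)\<^sup>2 = r k powr 2" "r k ^ n = r k powr (real n)"
        using r[of k] by (simp_all add: powr_realpow)
      then show ?thesis by (simp add: powr_add[symmetric] powr_diff[symmetric] a_def)
    qed
    also have "r k powr (2 - 2 * s) = R powr (2 - 2 * s) * (2 powr (2 * s - 2)) ^ k"
    proof -
      have "r k = R * 2 powr (- real k)" by (simp add: r_def powr_minus powr_realpow divide_inverse)
      then have "r k powr (2 - 2 * s) = R powr (2 - 2 * s) * 2 powr (- real k * (2 - 2 * s))"
        using R(1) by (simp add: powr_mult powr_powr)
      also have "2 powr (- real k * (2 - 2 * s)) = (2 powr (2 * s - 2)) ^ k"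
        by (simp add: powr_power algebra_simps)
      finally show ?thesis .
    qed
    finally show ?thesis by (simp add: mult_ac)
  qed
  have "2 powr (2 * s - 2) < (2::real) powr 0" using s by (intro powr_less_mono) auto
  then have "summable K"
    unfolding Keq[abs_def] by (intro summable_mult summable_geometric) simp
  \<comment> \<open>Shells are enlarged to balls, so the series only dominates the kernel. On the
    diagonal the left side is zero because its numerator vanishes.\<close>
  have pw: "ennreal ((u x - u y)\<^sup>2 / norm (x - y) powr a) * indicator \<Omega> y
      \<le> (\<Sum>k. ennreal (C k) * indicator (cball x (r k)) y)" if x: "x \<in> \<Omega>" for x y
  proof (cases "y \<in> \<Omega> \<and> x \<noteq> y")
    case True
    then obtain k where k: "R / 2 ^ Suc k < norm (x - y)" "norm (x - y) \<le> R / 2 ^ k"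
      using dyadic_scale[of "norm (x - y)" R] R(2)[OF x] by auto
    have "(u x - u y)\<^sup>2 / norm (x - y) powr a \<le> C k"
      unfolding C_def
    proof (intro frac_le)
      have "\<bar>u x - u y\<bar> \<le> L * norm (x - y)"
        using lipschitz_on_normD[OF lip x, of y] True by simp
      also have "\<dots> \<le> L * r k" using k L by (intro mult_left_mono) (auto simp: r_def)
      finally show "(u x - u y)\<^sup>2 \<le> (L * r k)\<^sup>2"
        using power_mono[of "\<bar>u x - u y\<bar>" "L * r k" 2] by simp
      show "r (Suc k) powr a \<le> norm (x - y) powr a"
        using k a r[of "Suc k"] by (intro powr_mono2) (auto simp: r_def)
    qed (use r[of "Suc k"] in auto)
    then have "ennreal ((u x - u y)\<^sup>2 / norm (x - y) powr a) * indicator \<Omega> y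
        \<le> ennreal (C k) * indicator (cball x (r k)) y"
      using True k by (auto simp: r_def dist_norm intro!: ennreal_leI)
    also have "\<dots> \<le> (\<Sum>k. ennreal (C k) * indicator (cball x (r k)) y)"
    proof -
      define h where "h k = ennreal (C k) * indicator (cball x (r k)) y" for k
      have "sum h {k} \<le> suminf h" by (rule sum_le_suminf) (auto intro: summableI)
      moreover have "sum h {k} = h k" by simp
      ultimately show ?thesis unfolding h_def by (simp only:)
    qed
    finally show ?thesis .
  qed (auto simp: indicator_def)
  have inner: "(\<integral>\<^sup>+y. ennreal ((u x - u y)\<^sup>2 / norm (x - y) powr a) \<partial>(lebesgue_on \<Omega>)) \<le> ennreal (suminf K)"
    if x: "x \<in> \<Omega>" for x
  proof -
    have "(\<integral>\<^sup>+y. ennreal ((u x - u y)\<^sup>2 / norm (x - y) powr a) \<partial>(lebesgue_on \<Omega>))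
        = (\<integral>\<^sup>+y. ennreal ((u x - u y)\<^sup>2 / norm (x - y) powr a) * indicator \<Omega> y \<partial>lebesgue)"
      using \<Omega>(1) by (intro nn_integral_restrict_space) simp
    also have "\<dots> \<le> (\<integral>\<^sup>+y. (\<Sum>k. ennreal (C k) * indicator (cball x (r k)) y) \<partial>lebesgue)"
      by (intro nn_integral_mono pw x)
    also have "\<dots> = (\<Sum>k. \<integral>\<^sup>+y. ennreal (C k) * indicator (cball x (r k)) y \<partial>lebesgue)"
      by (intro nn_integral_suminf borel_measurable_times_ennreal borel_measurable_indicator) auto
    also have "\<dots> = (\<Sum>k. ennreal (K k))"
    proof (rule suminf_cong)
      fix k
      have "emeasure lebesgue (cball x (r k)) = ennreal (V * r k ^ n)"
        using emeasure_cball[of "r k" x] r[of k] by (simp add: V_def n_def)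
      then show "(\<integral>\<^sup>+y. ennreal (C k) * indicator (cball x (r k)) y \<partial>lebesgue) = ennreal (K k)"
        using C by (simp add: nn_integral_cmult_indicator K_def ennreal_mult')
    qed
    also have "\<dots> = ennreal (suminf K)" using K \<open>summable K\<close> by (rule suminf_ennreal2)
    finally show ?thesis .
  qed
  have "(\<integral>\<^sup>+x. (\<integral>\<^sup>+y. ennreal ((u x - u y)\<^sup>2 / norm (x - y) powr a) \<partial>(lebesgue_on \<Omega>)) \<partial>(lebesgue_on \<Omega>))
      \<le> (\<integral>\<^sup>+x. ennreal (suminf K) \<partial>(lebesgue_on \<Omega>))"
    using \<Omega> by (intro nn_integral_mono inner) simp
  also have "\<dots> = ennreal (suminf K) * emeasure lebesgue \<Omega>"
    using \<Omega> by (simp add: emeasure_restrict_space)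
  also have "\<dots> < \<infinity>"
  proof -
    have "emeasure lebesgue \<Omega> < \<infinity>"
      using bounded_set_imp_lmeasurable[OF \<Omega>(2,1)] by (simp only: fmeasurable_def mem_Collect_eq infinity_ennreal_def)
    then show ?thesis by (simp only: ennreal_mult_less_top ennreal_less_top infinity_ennreal_def simp_thms)
  qed
  finally show ?thesis using u by (simp add: slobodetskii_space_def a_def n_def)
qed

lemma C1_lipschitz_on_cbox:
  fixes f :: "real^'n \<Rightarrow> real"
  assumes f: "\<And>x. GDERIV f x :> g x" and contg: "continuous_on UNIV g"
  obtains L where "L-lipschitz_on (cbox a b) f"
proof -
  have "bounded (g ` cbox a b)"
    by (intro compact_imp_bounded compact_continuous_image continuous_on_subset[OF contg]) auto
  then obtain L where L: "L > 0" "\<And>x. x \<in> cbox a b \<Longrightarrow> norm (g x) \<le> L" by (auto simp: bounded_pos)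
  have "L-lipschitz_on (cbox a b) f"
  proof (rule lipschitz_onI)
    fix x y assume xy: "x \<in> cbox a b" "y \<in> cbox a b"
    have "norm (f x - f y) \<le> L * norm (x - y)"
    proof (rule differentiable_bound[OF convex_box(1), of a b f "\<lambda>x h. h \<bullet> g x"])
      fix z assume z: "z \<in> cbox a b"
      show "(f has_derivative (\<lambda>h. h \<bullet> g z)) (at z within cbox a b)"
        using f[of z] by (simp add: gderiv_def has_derivative_at_withinI)
      show "onorm (\<lambda>h. h \<bullet> g z) \<le> L"
      proof (rule onorm_le)
        fix h
        have "norm (h \<bullet> g z) \<le> norm h * norm (g z)" using Cauchy_Schwarz_ineq2[of h "g z"] by simp
        also have "\<dots> \<le> norm h * L" using L(2)[OF z] by (intro mult_left_mono) auto
        finally show "norm (h \<bullet> g z) \<le> L * norm h" by (simp add: mult.commute)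
      qed
    qed (use xy in auto)
    then show "dist (f x) (f y) \<le> L * dist x y" by (simp add: dist_norm)
  qed (use L in simp)
  then show ?thesis using that by blast
qed

lemma lipschitz_on_sum_ex:
  fixes f :: "'i \<Rightarrow> 'a::metric_space \<Rightarrow> real"
  assumes "\<And>i. i \<in> I \<Longrightarrow> \<exists>L. L-lipschitz_on S (f i)"
  shows "\<exists>L. L-lipschitz_on S (\<lambda>x. \<Sum>i\<in>I. f i x)"
  using assms
proof (induction I rule: infinite_finite_induct)
  case (insert i I)
  obtain L where "L-lipschitz_on S (f i)" using insert.prems by blast
  moreover obtain M where "M-lipschitz_on S (\<lambda>x. \<Sum>i\<in>I. f i x)" using insert.IH insert.prems by blast
  ultimately have "(L + M)-lipschitz_on S (\<lambda>x. f i x + (\<Sum>i\<in>I. f i x))" by (rule lipschitz_on_add)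
  then show ?case using insert.hyps by auto
qed (auto intro: lipschitz_on_constant)

lemma cosine_product_lipschitz: "\<exists>L. L-lipschitz_on (cbox a b) (cosine_product k)"
  using C1_lipschitz_on_cbox[OF gderiv_cosine_product continuous_on_cosine_gradient] by metis

section \<open>Fourth-order expansion along the test family\<close>

lemma powr_taylor4:
  fixes q :: real
  shows "((\<lambda>v::real. ((1 + v) powr q - (1 + q * v + q * (q - 1) / 2 * v ^ 2 + q * (q - 1) * (q - 2) / 6 * v ^ 3
     + q * (q - 1) * (q - 2) * (q - 3) / 24 * v ^ 4)) / v ^ 4) \<longlongrightarrow> 0) (at 0)"
  by real_asymp

lemma powr_quartic_expansion:
  fixes \<alpha> \<beta> r :: real
  shows "((\<lambda>t::real. ((1 + \<alpha> * t ^ 2 + \<beta> * t ^ 4) powr r - 1 - r * \<alpha> * t ^ 2) / t ^ 4)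
    \<longlongrightarrow> r * \<beta> + r * (r - 1) / 2 * \<alpha>\<^sup>2) (at_right 0)"
proof -
  have *: "r * \<beta> + r * (r - 1) / 2 * \<alpha>\<^sup>2 = \<alpha> * (\<alpha> * ((r - 1) * r)) / 2 + \<beta> * r"
    by (simp add: power2_eq_square)
  show ?thesis unfolding * by real_asymp
qed

text \<open>The perturbation is O(t) uniformly on the cube, so the fourth-order Taylor remainder
  integrates to o(t^4), while the Taylor polynomial integrates exactly to a polynomial in t with the
  moments \<open>\<mu> i j\<close> as coefficients. The four vanishing moments remove the orders 1
  and 3 and the contribution of \<open>W\<close> at order 2.\<close>

lemma power_integral_expansion:
  fixes S W :: "real^'n \<Rightarrow> real" and q :: real
  assumes cont: "continuous_on UNIV S" "continuous_on UNIV W"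
  defines "\<mu> \<equiv> \<lambda>i j. \<integral>x. S x ^ i * W x ^ j \<partial>(lebesgue_on unit_cube)"
  assumes \<mu>: "\<mu> 1 0 = 0" "\<mu> 0 1 = 0" "\<mu> 1 1 = 0" "\<mu> 3 0 = 0"
  shows "((\<lambda>t. ((\<integral>x. \<bar>1 + (t * S x + t\<^sup>2 * W x)\<bar> powr q \<partial>(lebesgue_on unit_cube)) - 1 - q * (q - 1) / 2 * \<mu> 2 0 * t ^ 2) / t ^ 4)
    \<longlongrightarrow> q * (q - 1) / 2 * \<mu> 0 2 + q * (q - 1) * (q - 2) / 2 * \<mu> 2 1 + q * (q - 1) * (q - 2) * (q - 3) / 24 * \<mu> 4 0)
    (at_right 0)"
proof -
  let ?M = "lebesgue_on (unit_cube :: (real^'n) set)"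
  define k2 k3 k4 where "k2 = q * (q - 1) / 2" and "k3 = q * (q - 1) * (q - 2) / 6"
    and "k4 = q * (q - 1) * (q - 2) * (q - 3) / 24"
  define T where "T v = 1 + q * v + k2 * v ^ 2 + k3 * v ^ 3 + k4 * v ^ 4" for v
  define v where "v t x = t * S x + t\<^sup>2 * W x" for t x
  define rem where "rem t x = \<bar>1 + v t x\<bar> powr q - T (v t x)" for t x
  define m where "m i j x = S x ^ i * W x ^ j" for i j x
  have contv: "continuous_on UNIV (v t)" for t
    unfolding v_def[abs_def] by (intro continuous_intros cont)
  have contm: "continuous_on UNIV (m i j)" for i j
    unfolding m_def[abs_def] by (intro continuous_intros cont)
  have intm: "integrable ?M (m i j)" for i j by (rule cube_integrable_continuous[OF contm])
  have \<mu>_m: "\<mu> i j = (\<integral>x. m i j x \<partial>?M)" for i j by (simp add: \<mu>_def m_def)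
  have intT: "integrable ?M (\<lambda>x. T (v t x))" for t
    unfolding T_def by (intro cube_integrable_continuous continuous_intros contv)
  have "T (v t x) = m 0 0 x + (q * t) * m 1 0 x + (q * t ^ 2) * m 0 1 x
     + (k2 * t ^ 2) * m 2 0 x + (2 * k2 * t ^ 3) * m 1 1 x + (k2 * t ^ 4) * m 0 2 x
     + (k3 * t ^ 3) * m 3 0 x + (3 * k3 * t ^ 4) * m 2 1 x + (3 * k3 * t ^ 5) * m 1 2 x + (k3 * t ^ 6) * m 0 3 x
     + (k4 * t ^ 4) * m 4 0 x + (4 * k4 * t ^ 5) * m 3 1 x + (6 * k4 * t ^ 6) * m 2 2 x
     + (4 * k4 * t ^ 7) * m 1 3 x + (k4 * t ^ 8) * m 0 4 x" for t x
    unfolding T_def v_def m_def by algebra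
  then have intT_\<mu>: "(\<integral>x. T (v t x) \<partial>?M) = \<mu> 0 0 + (q * t) * \<mu> 1 0 + (q * t ^ 2) * \<mu> 0 1
     + (k2 * t ^ 2) * \<mu> 2 0 + (2 * k2 * t ^ 3) * \<mu> 1 1 + (k2 * t ^ 4) * \<mu> 0 2
     + (k3 * t ^ 3) * \<mu> 3 0 + (3 * k3 * t ^ 4) * \<mu> 2 1 + (3 * k3 * t ^ 5) * \<mu> 1 2 + (k3 * t ^ 6) * \<mu> 0 3
     + (k4 * t ^ 4) * \<mu> 4 0 + (4 * k4 * t ^ 5) * \<mu> 3 1 + (6 * k4 * t ^ 6) * \<mu> 2 2
     + (4 * k4 * t ^ 7) * \<mu> 1 3 + (k4 * t ^ 8) * \<mu> 0 4" for t
    unfolding \<mu>_m by (simp add: intm)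
  have \<mu>00: "\<mu> 0 0 = 1"
    by (simp add: \<mu>_def measure_restrict_space measure_unit_cube)
  have intTeq: "(\<integral>x. T (v t x) \<partial>?M) - 1 - k2 * \<mu> 2 0 * t ^ 2 =
     t ^ 4 * (k2 * \<mu> 0 2 + 3 * k3 * \<mu> 2 1 + k4 * \<mu> 4 0 + (3 * k3 * \<mu> 1 2 + 4 * k4 * \<mu> 3 1) * t
       + (k3 * \<mu> 0 3 + 6 * k4 * \<mu> 2 2) * t ^ 2 + 4 * k4 * \<mu> 1 3 * t ^ 3 + k4 * \<mu> 0 4 * t ^ 4)" for t
    unfolding intT_\<mu> \<mu>00 \<mu> by algebra
  have lim1: "((\<lambda>t. ((\<integral>x. T (v t x) \<partial>?M) - 1 - k2 * \<mu> 2 0 * t ^ 2) / t ^ 4)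
     \<longlongrightarrow> k2 * \<mu> 0 2 + 3 * k3 * \<mu> 2 1 + k4 * \<mu> 4 0) (at_right 0)"
  proof (rule Lim_transform_eventually)
    show "((\<lambda>t. k2 * \<mu> 0 2 + 3 * k3 * \<mu> 2 1 + k4 * \<mu> 4 0 + (3 * k3 * \<mu> 1 2 + 4 * k4 * \<mu> 3 1) * t
       + (k3 * \<mu> 0 3 + 6 * k4 * \<mu> 2 2) * t ^ 2 + 4 * k4 * \<mu> 1 3 * t ^ 3 + k4 * \<mu> 0 4 * t ^ 4)
       \<longlongrightarrow> k2 * \<mu> 0 2 + 3 * k3 * \<mu> 2 1 + k4 * \<mu> 4 0) (at_right 0)"
      by (auto intro!: tendsto_eq_intros)
    show "\<forall>\<^sub>F t in at_right 0. k2 * \<mu> 0 2 + 3 * k3 * \<mu> 2 1 + k4 * \<mu> 4 0 + (3 * k3 * \<mu> 1 2 + 4 * k4 * \<mu> 3 1) * t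
       + (k3 * \<mu> 0 3 + 6 * k4 * \<mu> 2 2) * t ^ 2 + 4 * k4 * \<mu> 1 3 * t ^ 3 + k4 * \<mu> 0 4 * t ^ 4
       = ((\<integral>x. T (v t x) \<partial>?M) - 1 - k2 * \<mu> 2 0 * t ^ 2) / t ^ 4"
      using eventually_at_right_less[of 0] by eventually_elim (simp add: intTeq)
  qed
  obtain K1 where K1: "K1 > 0" "\<And>x. x \<in> cbox 0 1 \<Longrightarrow> \<bar>S x\<bar> \<le> K1" using cube_bounded_continuous[OF cont(1)] by blast
  obtain K2 where K2: "K2 > 0" "\<And>x. x \<in> cbox 0 1 \<Longrightarrow> \<bar>W x\<bar> \<le> K2" using cube_bounded_continuous[OF cont(2)] by blast
  define K where "K = K1 + K2"
  have K: "K > 0" using K1 K2 by (simp add: K_def)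
  have vK: "\<bar>v t x\<bar> \<le> t * K" if "x \<in> unit_cube" "0 < t" "t \<le> 1" for t x
  proof -
    have x: "x \<in> cbox 0 1" using that(1) box_subset_cbox by (auto simp: unit_cube_eq_box)
    have "\<bar>v t x\<bar> \<le> t * \<bar>S x\<bar> + t\<^sup>2 * \<bar>W x\<bar>"
      unfolding v_def using abs_triangle_ineq[of "t * S x" "t\<^sup>2 * W x"] that by (simp add: abs_mult)
    also have "\<dots> \<le> t * K1 + t * K2"
    proof (intro add_mono mult_mono)
      show "t\<^sup>2 \<le> t" using that by (simp add: power2_eq_square mult_left_le)
    qed (use that K1 K2 x in auto)
    finally show ?thesis by (simp add: K_def distrib_left)
  qed
  have rem_int: "((\<lambda>t. (\<integral>x. rem t x \<partial>?M) / t ^ 4) \<longlongrightarrow> 0) (at_right 0)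
      \<and> (\<forall>\<^sub>F t in at_right 0. integrable ?M (rem t))"
  proof -
    \<comment> \<open>Integrability is proved together with the estimate: for arbitrary real
      \<open>q\<close> the power may be singular where \<open>1 + v\<close> vanishes, and small
      \<open>t\<close> excludes this.\<close>
    have bound: "\<forall>\<^sub>F t in at_right 0. integrable ?M (rem t) \<and> \<bar>\<integral>x. rem t x \<partial>?M\<bar> / t ^ 4 \<le> e" if "e > 0" for e
    proof -
      define \<delta> where "\<delta> = e / K ^ 4"
      have \<delta>: "\<delta> > 0" using that K by (simp add: \<delta>_def)
      have "\<forall>\<^sub>F v in at 0. dist (((1 + v) powr q - T v) / v ^ 4) 0 < \<delta>"
        using tendstoD[OF powr_taylor4[of q] \<delta>] by (simp add: T_def k2_def k3_def k4_def)
      then obtain \<rho>0 where \<rho>0: "\<rho>0 > 0"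
        and R0: "\<And>v. v \<noteq> 0 \<Longrightarrow> \<bar>v\<bar> < \<rho>0 \<Longrightarrow> \<bar>((1 + v) powr q - T v) / v ^ 4\<bar> < \<delta>"
        unfolding eventually_at by (auto simp: dist_real_def)
      define \<rho> where "\<rho> = min \<rho>0 1"
      have \<rho>: "\<rho> > 0" using \<rho>0 by (simp add: \<rho>_def)
      have R: "\<bar>\<bar>1 + v\<bar> powr q - T v\<bar> \<le> \<delta> * v ^ 4" if "\<bar>v\<bar> < \<rho>" for v
      proof (cases "v = 0")
        case False
        have "\<bar>1 + v\<bar> = 1 + v" using that by (auto simp: \<rho>_def)
        moreover have "\<bar>(1 + v) powr q - T v\<bar> / v ^ 4 < \<delta>"
          using R0[OF False] that by (simp add: \<rho>_def abs_divide)
        moreover have "v ^ 4 > 0" using False by simp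
        ultimately show ?thesis by (simp add: divide_less_eq)
      qed (simp add: T_def)
      have "\<forall>\<^sub>F t in at_right 0. t < min 1 (\<rho> / K)"
        by (rule eventually_at_right_real[of 0 "min 1 (\<rho> / K)", THEN eventually_mono]) (use \<rho> K in auto)
      with eventually_at_right_less[of 0] show ?thesis
      proof eventually_elim
        case (elim t)
        then have t: "0 < t" "t \<le> 1" "t * K < \<rho>" using K by (auto simp: pos_less_divide_eq)
        have pw: "\<bar>rem t x\<bar> \<le> e * t ^ 4" if "x \<in> unit_cube" for x
        proof -
          have "\<bar>rem t x\<bar> \<le> \<delta> * v t x ^ 4"
            unfolding rem_def using vK[OF that t(1,2)] t(3) by (intro R) simp
          also have "\<dots> \<le> \<delta> * (t * K) ^ 4"
            using power_mono[OF vK[OF that t(1,2)], of 4] \<delta> by (intro mult_left_mono) auto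
          also have "\<dots> = e * t ^ 4" using K by (simp add: \<delta>_def power_mult_distrib)
          finally show ?thesis .
        qed
        have meas: "rem t \<in> borel_measurable ?M"
          unfolding rem_def[abs_def] using intT[of t] cube_measurable_continuous[OF contv[of t]] by measurable
        have int: "integrable ?M (rem t)" by (rule cube_integrable_bounded[OF meas pw])
        have "\<bar>\<integral>x. rem t x \<partial>?M\<bar> \<le> (\<integral>x. \<bar>rem t x\<bar> \<partial>?M)" by (rule integral_abs_bound)
        also have "\<dots> \<le> (\<integral>x. e * t ^ 4 \<partial>?M)"
          using int pw by (intro integral_mono integrable_abs cube_integrable_continuous[OF continuous_on_const]) auto
        also have "\<dots> = e * t ^ 4" by (simp add: measure_restrict_space measure_unit_cube)
        finally show ?case using int t by (simp add: divide_le_eq)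
      qed
    qed
    show ?thesis
    proof
      show "\<forall>\<^sub>F t in at_right 0. integrable ?M (rem t)"
        using bound[OF zero_less_one] by (auto elim: eventually_mono)
      show "((\<lambda>t. (\<integral>x. rem t x \<partial>?M) / t ^ 4) \<longlongrightarrow> 0) (at_right 0)"
      proof (rule tendstoI)
        fix e :: real assume "e > 0"
        have "\<forall>\<^sub>F t in at_right 0. \<bar>\<integral>x. rem t x \<partial>?M\<bar> / t ^ 4 \<le> e / 2"
          using bound[of "e / 2"] \<open>e > 0\<close> by (auto elim: eventually_mono)
        then show "\<forall>\<^sub>F t in at_right 0. dist ((\<integral>x. rem t x \<partial>?M) / t ^ 4) 0 < e"
        proof (rule eventually_mono)
          fix t :: real assume t: "\<bar>\<integral>x. rem t x \<partial>?M\<bar> / t ^ 4 \<le> e / 2"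
          have "dist ((\<integral>x. rem t x \<partial>?M) / t ^ 4) 0 = \<bar>\<integral>x. rem t x \<partial>?M\<bar> / t ^ 4"
            by (simp add: dist_real_def abs_divide)
          then show "dist ((\<integral>x. rem t x \<partial>?M) / t ^ 4) 0 < e" using t \<open>e > 0\<close> by linarith
        qed
      qed
    qed
  qed
  have "((\<lambda>t. ((\<integral>x. T (v t x) \<partial>?M) - 1 - k2 * \<mu> 2 0 * t ^ 2) / t ^ 4 + (\<integral>x. rem t x \<partial>?M) / t ^ 4)
      \<longlongrightarrow> (k2 * \<mu> 0 2 + 3 * k3 * \<mu> 2 1 + k4 * \<mu> 4 0) + 0) (at_right 0)"
    using rem_int by (intro tendsto_add lim1) auto
  moreover have "\<forall>\<^sub>F t in at_right 0. ((\<integral>x. T (v t x) \<partial>?M) - 1 - k2 * \<mu> 2 0 * t ^ 2) / t ^ 4 + (\<integral>x. rem t x \<partial>?M) / t ^ 4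
      = ((\<integral>x. \<bar>1 + v t x\<bar> powr q \<partial>?M) - 1 - k2 * \<mu> 2 0 * t ^ 2) / t ^ 4"
    using rem_int[THEN conjunct2]
  proof eventually_elim
    case (elim t)
    have "(\<integral>x. \<bar>1 + v t x\<bar> powr q \<partial>?M) = (\<integral>x. T (v t x) + rem t x \<partial>?M)" by (simp add: rem_def)
    also have "\<dots> = (\<integral>x. T (v t x) \<partial>?M) + (\<integral>x. rem t x \<partial>?M)"
      by (rule Bochner_Integration.integral_add[OF intT elim])
    finally show ?case by (simp add: add_divide_distrib diff_divide_distrib)
  qed
  ultimately have L: "((\<lambda>t. ((\<integral>x. \<bar>1 + v t x\<bar> powr q \<partial>?M) - 1 - k2 * \<mu> 2 0 * t ^ 2) / t ^ 4)
      \<longlongrightarrow> (k2 * \<mu> 0 2 + 3 * k3 * \<mu> 2 1 + k4 * \<mu> 4 0) + 0) (at_right 0)"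
    by (rule Lim_transform_eventually)
  have eq: "(k2 * \<mu> 0 2 + 3 * k3 * \<mu> 2 1 + k4 * \<mu> 4 0) + 0
      = q * (q - 1) / 2 * \<mu> 0 2 + q * (q - 1) * (q - 2) / 2 * \<mu> 2 1 + q * (q - 1) * (q - 2) * (q - 3) / 24 * \<mu> 4 0"
    by (simp add: k2_def k3_def k4_def)
  show ?thesis using L unfolding eq unfolding v_def k2_def .
qed

section \<open>Sign of the fourth-order coefficient\<close>

lemma two_powr_le:
  fixes s :: real
  assumes "0 \<le> s" "s \<le> 1"
  shows "2 powr s \<le> 1 + s"
proof -
  \<comment> \<open>The chord of the exponential between 0 and \<open>ln 2\<close> lies above its
    graph.\<close>
  have "exp ((1 - s) *\<^sub>R 0 + s *\<^sub>R ln 2) \<le> (1 - s) * exp 0 + s * exp (ln (2::real))"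
    using assms by (intro convex_onD[OF exp_convex]) auto
  then show ?thesis by (simp add: powr_def)
qed

text \<open>Up to the factor \<open>q - 2\<close>, the quantity below is the coefficient of \<open>t\<^sup>4\<close> in
  \<open>I[u\<^sub>t] / I[1] - 1\<close>. With \<open>2\<^sup>s \<le> 1 + s\<close> it is bounded by a convex quadratic function of \<open>a, b\<close>, which
  the proof minimises.\<close>

lemma fourth_order_coefficient_negative:
  fixes n :: nat and s :: real
  assumes n: "n \<ge> 1" and s: "0 < s" "s < 1" "s < real n / 2"
  defines "p \<equiv> critical_exponent n s - 1"
  defines "X \<equiv> real n / 2" and "Y \<equiv> real n * (real n - 1) / 2"
  shows "\<exists>a b. (4 powr s - 1) * b\<^sup>2 * X + (2 powr s - 1) * a\<^sup>2 * Y - p * (b * X / 2 + a * Y)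
    - p * (p - 2) / 12 * ((real n)\<^sup>2 / 4 + X / 4 + Y) + p\<^sup>2 * (real n)\<^sup>2 / 16 < 0"
proof (cases "n = 1")
  case True
  have p: "p = (1 + 2 * s) / (1 - 2 * s)" using True s by (simp add: p_def critical_exponent_def field_simps)
  have p0: "p > 0" using True s by (simp add: p)
  have "4 powr s = (2::real) powr (2 * s)" using powr_powr[of 2 2 s] by simp
  \<comment> \<open>In dimension one \<open>2 * s < 1\<close>, so the chord bound applies to the
    exponent \<open>2 * s\<close>. The weaker bound \<open>3 * s\<close> of the other case would not
    suffice here for \<open>s\<close> between 1/3 and 1/2.\<close>
  then have 4: "4 powr s - 1 \<le> 2 * s" using two_powr_le[of "2 * s"] s True by simp
  \<comment> \<open>The vertex of the parabola with leading coefficient \<open>2 * s\<close>; the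
    pair direction is absent since \<open>Y = 0\<close>.\<close>
  define b where "b = p / (8 * s)"
  have "p * (1 - 2 * s) > 4 * s" using True s by (simp add: p)
  then have "- p + s * (2 * p + 4) < 0" by (simp add: algebra_simps)
  then have "p / (64 * s) * (- p + s * (2 * p + 4)) < 0" using p0 s by (intro mult_pos_neg) auto
  also have "p / (64 * s) * (- p + s * (2 * p + 4)) = 2 * s * b\<^sup>2 / 2 - p * b / 4 - p * (p - 2) / 32 + p\<^sup>2 / 16"
    using s by (simp add: b_def field_simps power2_eq_square)
  finally have "2 * s * b\<^sup>2 / 2 - p * b / 4 - p * (p - 2) / 32 + p\<^sup>2 / 16 < 0" .
  moreover have "(4 powr s - 1) * b\<^sup>2 \<le> 2 * s * b\<^sup>2" using 4 by (intro mult_right_mono) auto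
  ultimately have "(4 powr s - 1) * b\<^sup>2 / 2 - p * b / 4 - p * (p - 2) / 32 + p\<^sup>2 / 16 < 0" by linarith
  then show ?thesis using True by (intro exI[of _ 0] exI[of _ b]) (simp add: X_def Y_def field_simps power2_eq_square)
next
  case False
  define N where "N = real n"
  have N: "N \<ge> 2" using n False by (simp add: N_def)
  have d: "N - 2 * s > 0" using s by (simp add: N_def)
  have p: "p = (N + 2 * s) / (N - 2 * s)" using d by (simp add: p_def critical_exponent_def N_def field_simps)
  have p0: "p > 0" using N s d by (simp add: p)
  have 2: "2 powr s - 1 \<le> s" using two_powr_le[of s] s by simp
  have "4 powr s = (2 powr s)\<^sup>2" using powr_mult[of 2 2 s] by (simp add: power2_eq_square)
  also have "\<dots> \<le> (1 + s)\<^sup>2" using two_powr_le[of s] s by (intro power_mono) auto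
  also have "\<dots> \<le> 1 + 3 * s" using s by (simp add: power2_eq_square algebra_simps)
  finally have 4: "4 powr s - 1 \<le> 3 * s" by simp
  \<comment> \<open>The variables separate: these are the vertices of
    \<open>s * a\<^sup>2 - p * a\<close> and \<open>3 * s * b\<^sup>2 - p * b / 2\<close>.\<close>
  define a b where "a = p / (2 * s)" and "b = p / (12 * s)"
  have XY: "X \<ge> 0" "Y \<ge> 0" using N by (auto simp: X_def Y_def N_def[symmetric])
  \<comment> \<open>The three expressions add up exactly to the polynomial whose positivity is
    claimed next, which is the sign condition at the vertices after multiplying by
    \<open>N - 2 * s\<close>.\<close>
  have "0 \<le> (12 * N - 11) * N * (1 - s)" "0 < s * (16 * N - 22)" "0 < s\<^sup>2 * (24 * N - 18)"
    using N s by (auto intro!: mult_nonneg_nonneg mult_pos_pos)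
  then have "(N + 2 * s) * (12 * N - 11 - 3 * s) - s * (12 * N - 6) * (N - 2 * s) > 0"
    by (simp add: algebra_simps power2_eq_square)
  then have "s * (12 * N - 6) * (N - 2 * s) < (N + 2 * s) * (12 * N - 11 - 3 * s)" by simp
  then have "s * (12 * N - 6) < p * (12 * N - 11 - 3 * s)"
    using d by (simp add: p pos_less_divide_eq)
  then have "- p * (12 * N - 11) + s * (3 * p + 12 * N - 6) < 0" by (simp add: algebra_simps)
  then have "N * p / (96 * s) * (- p * (12 * N - 11) + s * (3 * p + 12 * N - 6)) < 0"
    using p0 s N by (intro mult_pos_neg) auto
  also have "N * p / (96 * s) * (- p * (12 * N - 11) + s * (3 * p + 12 * N - 6)) =
     3 * s * b\<^sup>2 * X + s * a\<^sup>2 * Y - p * (b * X / 2 + a * Y)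
     - p * (p - 2) / 12 * (N\<^sup>2 / 4 + X / 4 + Y) + p\<^sup>2 * N\<^sup>2 / 16"
    using s unfolding a_def b_def X_def Y_def N_def[symmetric] by (simp add: field_simps power2_eq_square)
  finally have "3 * s * b\<^sup>2 * X + s * a\<^sup>2 * Y - p * (b * X / 2 + a * Y)
     - p * (p - 2) / 12 * (N\<^sup>2 / 4 + X / 4 + Y) + p\<^sup>2 * N\<^sup>2 / 16 < 0" .
  moreover have "(4 powr s - 1) * b\<^sup>2 * X \<le> 3 * s * b\<^sup>2 * X"
    using 4 XY by (intro mult_right_mono) auto
  moreover have "(2 powr s - 1) * a\<^sup>2 * Y \<le> s * a\<^sup>2 * Y"
    using 2 XY by (intro mult_right_mono) auto
  ultimately show ?thesis
    unfolding N_def by (intro exI[of _ a] exI[of _ b]) linarith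
qed

section \<open>Comparison of the quartic coefficients under the assumption of minimality\<close>

theorem proposition1:
  fixes s q \<epsilon> :: real
    and ev :: "nat \<Rightarrow> real"
    and \<phi> :: "nat \<Rightarrow> real^'n \<Rightarrow> real"
  assumes "0 < s" and "s < 1" and "s < real CARD('n) / 2"
    and "neumann_eigensystem (unit_cube :: (real^'n) set) ev \<phi>"
    and "q = critical_exponent CARD('n) s"
    and "\<epsilon> = threshold_eps ev s q"
  shows "\<not> global_minimizer (unit_cube :: (real^'n) set) ev \<phi> s q \<epsilon> (\<lambda>x. 1)"
proof
  assume minimizer: "global_minimizer (unit_cube :: (real^'n) set) ev \<phi> s q \<epsilon> (\<lambda>x. 1)"
  note s = assms(1-3) and sys = assms(4)
  define n where "n = real CARD('n)"
  let ?\<Omega> = "unit_cube :: (real^'n) set"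
  let ?M = "lebesgue_on ?\<Omega>"
  let ?i = "L2_inner ?\<Omega>"
  let ?S = "cos_sum :: real^'n \<Rightarrow> real"
  let ?D = "cos2_sum :: real^'n \<Rightarrow> real"
  let ?P = "cos_pair_sum :: real^'n \<Rightarrow> real"
  have basis: "L2_orthonormal_basis ?\<Omega> \<phi>" and ev0: "ev 0 = 0"
    using sys by (auto simp: neumann_eigensystem_def)
  define X Y where "X = n / 2" and "Y = n * (n - 1) / 2"
  define p where "p = q - 1"
  have n: "n \<ge> 1" "n - 2 * s > 0" using s by (auto simp: n_def Suc_le_eq)
  have q: "q = 2 * n / (n - 2 * s)" using assms(5) by (simp add: critical_exponent_def n_def)
  have q2: "q > 2" using n s by (simp add: q pos_less_divide_eq)
  obtain a b where ab: "(4 powr s - 1) * b\<^sup>2 * X + (2 powr s - 1) * a\<^sup>2 * Y - p * (b * X / 2 + a * Y)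
      - p * (p - 2) / 12 * (n\<^sup>2 / 4 + X / 4 + Y) + p\<^sup>2 * n\<^sup>2 / 16 < 0"
    using fourth_order_coefficient_negative[of "CARD('n)" s] s
    unfolding p_def assms(5) X_def Y_def n_def by (auto simp: Suc_le_eq)
  define W where "W x = b * ?D x + a * ?P x" for x
  define u where "u t x = 1 + (t * ?S x + t\<^sup>2 * W x)" for t x

  note eig = cos_sum_in_eigenspace[OF sys]
  have L2: "L2_fun ?\<Omega> ?S" "L2_fun ?\<Omega> ?D" "L2_fun ?\<Omega> ?P" "L2_fun ?\<Omega> (\<lambda>x. c)" for c
    by (intro L2_fun_continuous continuous_intros)+
  note orth = in_eigenspace_orthogonal[OF basis]
  have o: "?i ?S (\<lambda>x. 1) = 0" "?i ?S ?D = 0" "?i ?S ?P = 0" "?i ?D (\<lambda>x. 1) = 0" "?i ?P (\<lambda>x. 1) = 0" "?i ?D ?P = 0"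
    using orth[OF eig(1) eig(4)] orth[OF eig(1) eig(2)] orth[OF eig(1) eig(3)]
      orth[OF eig(2) eig(4)] orth[OF eig(3) eig(4)] orth[OF eig(2) eig(3)] by auto
  have o': "?i (\<lambda>x. 1) ?S = 0" "?i ?D ?S = 0" "?i ?P ?S = 0" "?i (\<lambda>x. 1) ?D = 0" "?i (\<lambda>x. 1) ?P = 0" "?i ?P ?D = 0"
    using o by (simp_all add: L2_inner_commute)
  have DD: "?i ?D ?D = X" and PP: "?i ?P ?P = Y" and one: "?i (\<lambda>x. 1) (\<lambda>x. 1) = 1"
    by (simp_all add: L2_norm_cos2_sum L2_norm_cos_pair_sum X_def Y_def n_def L2_inner_cube_const)
  \<comment> \<open>The functions 1, \<open>W\<close> and the square of \<open>?S\<close> all lie in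
    the span of the orthogonal family 1, \<open>?D\<close>, \<open>?P\<close>. In these coordinates
    every moment below becomes a scalar product of triples or a product with \<open>?S\<close>,
    which is orthogonal to the span.\<close>
  define comb where "comb c x = fst c * 1 + (fst (snd c) * ?D x + snd (snd c) * ?P x)" for c :: "real \<times> real \<times> real" and x
  have L2c: "L2_fun ?\<Omega> (comb c)" for c
    unfolding comb_def[abs_def] by (intro L2_fun_add L2_fun_scale L2)
  have inner_comb: "?i (comb c) (comb d) = fst c * fst d + fst (snd c) * fst (snd d) * X + snd (snd c) * snd (snd d) * Y" for c d
    unfolding comb_def[abs_def]
    by (simp only: L2_inner_add_left L2_inner_add_right L2_inner_scale_left L2_inner_scale_right
        L2 L2_fun_add L2_fun_scale o o' DD PP one) simp
  have inner_S: "?i ?S (comb c) = 0" for c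
    unfolding comb_def[abs_def]
    by (simp only: L2_inner_add_right L2_inner_scale_right L2 L2_fun_add L2_fun_scale o o' mult_zero_right add_0_left)
  have W: "W = comb (0, b, a)" and one_comb: "(\<lambda>x. 1) = comb (1, 0, 0)"
    and S2: "(\<lambda>x. (?S x)\<^sup>2) = comb (n / 2, 1 / 2, 1)"
    by (simp_all add: fun_eq_iff W_def comb_def cos_sum_square n_def)
  have SS: "?i ?S ?S = n / 2"
  proof -
    have "?i ?S ?S = ?i (\<lambda>x. (?S x)\<^sup>2) (\<lambda>x. 1)" by (simp add: L2_inner_def power2_eq_square)
    then show ?thesis unfolding S2 one_comb inner_comb by simp
  qed
  have contW: "continuous_on UNIV W" unfolding W_def[abs_def] by (intro continuous_intros)
  have contu: "continuous_on UNIV (u t)" for t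
    unfolding u_def[abs_def] by (intro continuous_intros contW)
  have L2u: "L2_fun ?\<Omega> (u t)" for t by (rule L2_fun_continuous[OF contu])

  define \<mu> where "\<mu> i j = (\<integral>x. ?S x ^ i * W x ^ j \<partial>?M)" for i j :: nat
  have \<mu>: "\<mu> 1 0 = 0" "\<mu> 0 1 = 0" "\<mu> 1 1 = 0" "\<mu> 3 0 = 0"
    "\<mu> 2 0 = n / 2" "\<mu> 0 2 = b\<^sup>2 * X + a\<^sup>2 * Y" "\<mu> 2 1 = b * X / 2 + a * Y" "\<mu> 4 0 = n\<^sup>2 / 4 + X / 4 + Y"
  proof -
    \<comment> \<open>In particular the third moment is the scalar product of \<open>?S\<close> with
      its own square, which has no component along \<open>?S\<close>.\<close>
    have "\<mu> 1 0 = ?i ?S (comb (1, 0, 0))" "\<mu> 0 1 = ?i W (comb (1, 0, 0))" "\<mu> 1 1 = ?i ?S W"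
      "\<mu> 3 0 = ?i ?S (comb (n / 2, 1 / 2, 1))" "\<mu> 2 0 = ?i (comb (n / 2, 1 / 2, 1)) (comb (1, 0, 0))"
      "\<mu> 0 2 = ?i W W" "\<mu> 2 1 = ?i (comb (n / 2, 1 / 2, 1)) W"
      "\<mu> 4 0 = ?i (comb (n / 2, 1 / 2, 1)) (comb (n / 2, 1 / 2, 1))"
      unfolding S2[symmetric] one_comb[symmetric]
      by (simp_all add: \<mu>_def L2_inner_def power2_eq_square power3_eq_cube power4_eq_xxxx mult.assoc)
    then show "\<mu> 1 0 = 0" "\<mu> 0 1 = 0" "\<mu> 1 1 = 0" "\<mu> 3 0 = 0"
      "\<mu> 2 0 = n / 2" "\<mu> 0 2 = b\<^sup>2 * X + a\<^sup>2 * Y" "\<mu> 2 1 = b * X / 2 + a * Y" "\<mu> 4 0 = n\<^sup>2 / 4 + X / 4 + Y"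
      by (simp_all add: W inner_comb inner_S power2_eq_square)
  qed

  define \<Lambda> where "\<Lambda> = (pi\<^sup>2) powr s"
  have \<Lambda>: "\<Lambda> > 0" by (simp add: \<Lambda>_def)
  define E where "E = \<Lambda> / (q - 2)"
  have E0: "E > 0" using \<Lambda> q2 by (simp add: E_def)
  have \<Lambda>E: "\<Lambda> = E * (q - 2)" using q2 by (simp add: E_def)
  have "\<epsilon> = E powr (1 / (2 * s))"
    unfolding assms(6) threshold_eps_def first_neumann_eigenvalue[OF sys] E_def \<Lambda>_def ..
  then have \<epsilon>: "\<epsilon> powr (2 * s) = E"
    using s(1) E0 by (simp add: powr_powr)
  have spectral: "spectral_form ?\<Omega> ev \<phi> s (u t)
      = \<Lambda> * (t\<^sup>2 * (n / 2) + t ^ 4 * (4 powr s * b\<^sup>2 * X + 2 powr s * a\<^sup>2 * Y))" for t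
  proof -
    \<comment> \<open>Four components with pairwise distinct eigenvalues. In dimension one the last
      component is zero and lies in the space for \<open>2 * pi\<^sup>2\<close> trivially.\<close>
    define \<nu> where "\<nu> i = [0, pi\<^sup>2, 4 * pi\<^sup>2, 2 * pi\<^sup>2] ! i" for i :: nat
    define f where "f i = [(\<lambda>x. 1), (\<lambda>x. t * ?S x), (\<lambda>x. (t\<^sup>2 * b) * ?D x), (\<lambda>x. (t\<^sup>2 * a) * ?P x)] ! i" for i :: nat
    have u: "u t = (\<lambda>x. \<Sum>i\<in>{0, 1, 2, 3}. f i x)"
      by (simp add: u_def W_def f_def fun_eq_iff numeral_eq_Suc algebra_simps)
    have "spectral_form ?\<Omega> ev \<phi> s (u t) = (\<Sum>i\<in>{0, 1, 2, 3}. \<nu> i powr s * ?i (f i) (f i))"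
      unfolding u
    proof (rule spectral_form_sum_eigenspaces[where ev = ev, OF basis ev0])
      show "inj_on \<nu> {0, 1, 2, 3}" by (auto simp: inj_on_def \<nu>_def numeral_eq_Suc)
      show "in_eigenspace ?\<Omega> ev \<phi> (\<nu> i) (f i)" if "i \<in> {0, 1, 2, 3}" for i
        using that eig(4) in_eigenspace_scale[OF eig(1), of t] in_eigenspace_scale[OF eig(2), of "t\<^sup>2 * b"]
          in_eigenspace_scale[OF eig(3), of "t\<^sup>2 * a"]
        by (auto simp: \<nu>_def f_def numeral_eq_Suc)
    qed simp
    also have "\<dots> = \<Lambda> * (t * t * (n / 2)) + (4 * pi\<^sup>2) powr s * (t\<^sup>2 * b * (t\<^sup>2 * b) * X)
        + (2 * pi\<^sup>2) powr s * (t\<^sup>2 * a * (t\<^sup>2 * a) * Y)"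
    proof -
      have "\<nu> 0 = 0" "\<nu> 1 = pi\<^sup>2" "\<nu> 2 = 4 * pi\<^sup>2" "\<nu> 3 = 2 * pi\<^sup>2"
        "f 1 = (\<lambda>x. t * ?S x)" "f 2 = (\<lambda>x. (t\<^sup>2 * b) * ?D x)" "f 3 = (\<lambda>x. (t\<^sup>2 * a) * ?P x)"
        by (simp_all add: \<nu>_def f_def numeral_eq_Suc)
      then show ?thesis
        by (simp add: L2_inner_scale_left L2_inner_scale_right SS DD PP \<Lambda>_def)
    qed
    also have "\<dots> = \<Lambda> * (t\<^sup>2 * (n / 2) + t ^ 4 * (4 powr s * b\<^sup>2 * X + 2 powr s * a\<^sup>2 * Y))"
      unfolding powr_mult[of 4 "pi\<^sup>2" s, simplified] powr_mult[of 2 "pi\<^sup>2" s, simplified] \<Lambda>_def[symmetric]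
      by algebra
    finally show ?thesis .
  qed
  have normu: "?i (u t) (u t) = 1 + t\<^sup>2 * (n / 2) + t ^ 4 * (b\<^sup>2 * X + a\<^sup>2 * Y)" for t
  proof -
    have "u t = (\<lambda>x. t * ?S x + comb (1, t\<^sup>2 * b, t\<^sup>2 * a) x)"
      by (simp add: u_def W_def comb_def fun_eq_iff algebra_simps)
    then have "?i (u t) (u t) = t * t * (n / 2) + (1 + t\<^sup>2 * b * (t\<^sup>2 * b) * X + t\<^sup>2 * a * (t\<^sup>2 * a) * Y)"
      by (simp add: L2_inner_add_left L2_inner_add_right L2_inner_scale_left L2_inner_scale_right
          L2 L2_fun_add L2_fun_scale L2c SS inner_S L2_inner_commute[of _ "comb _" ?S] inner_comb)
    then show ?thesis by (simp add: power2_eq_square power4_eq_xxxx algebra_simps)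
  qed
  define I where "I t = (\<integral>x. \<bar>u t x\<bar> powr q \<partial>?M)" for t
  \<comment> \<open>Coefficients of the numerator divided by \<open>E\<close>; with
    \<open>\<Lambda> = E * (q - 2)\<close> the factor \<open>q - 2\<close> of the spectral part and
    1 of the norm part add up to \<open>q - 1\<close> in \<open>\<alpha>\<close>.\<close>
  define \<alpha> \<beta> where "\<alpha> = (q - 1) * (n / 2)"
    and "\<beta> = (q - 2) * (4 powr s * b\<^sup>2 * X + 2 powr s * a\<^sup>2 * Y) + b\<^sup>2 * X + a\<^sup>2 * Y"
  define N where "N t = 1 + \<alpha> * t ^ 2 + \<beta> * t ^ 4" for t
  have energy: "energy_quotient ?\<Omega> ev \<phi> s q \<epsilon> (u t) = E * N t / I t powr (2 / q)" for t
  proof -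
    have "(Lp_norm ?\<Omega> q (u t))\<^sup>2 = I t powr (2 / q)"
      by (simp add: Lp_norm_def I_def[symmetric] power2_eq_square powr_add[symmetric])
    moreover have "\<Lambda> * (t\<^sup>2 * (n / 2) + t ^ 4 * (4 powr s * b\<^sup>2 * X + 2 powr s * a\<^sup>2 * Y))
        + E * (1 + t\<^sup>2 * (n / 2) + t ^ 4 * (b\<^sup>2 * X + a\<^sup>2 * Y)) = E * N t"
      unfolding N_def \<alpha>_def \<beta>_def \<Lambda>E by (simp add: field_simps)
    ultimately show ?thesis
      unfolding energy_quotient_def spectral \<epsilon> Lp_norm_2_square normu by simp
  qed
  have slob: "u t \<in> slobodetskii_space ?\<Omega> s" for t
  proof -
    have "\<exists>L. L-lipschitz_on (cbox 0 1) ?S" "\<exists>L. L-lipschitz_on (cbox 0 1) ?D" "\<exists>L. L-lipschitz_on (cbox 0 1) ?P"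
      unfolding cos_sum_eq cos2_sum_eq cos_pair_sum_eq by (intro lipschitz_on_sum_ex cosine_product_lipschitz)+
    then obtain L1 L2 L3 where L: "L1-lipschitz_on (cbox 0 1) ?S" "L2-lipschitz_on (cbox 0 1) ?D" "L3-lipschitz_on (cbox 0 1) ?P"
      by blast
    have "(0 + (\<bar>t\<bar> * L1 + \<bar>t\<^sup>2\<bar> * (\<bar>b\<bar> * L2 + \<bar>a\<bar> * L3)))-lipschitz_on (cbox 0 1) (u t)"
      unfolding u_def[abs_def] W_def
      by (intro lipschitz_on_add lipschitz_on_cmult_real lipschitz_on_constant L)
    then have "(0 + (\<bar>t\<bar> * L1 + \<bar>t\<^sup>2\<bar> * (\<bar>b\<bar> * L2 + \<bar>a\<bar> * L3)))-lipschitz_on ?\<Omega> (u t)"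
      by (rule lipschitz_on_subset) (simp add: unit_cube_eq_box box_subset_cbox)
    then show ?thesis
      by (intro lipschitz_in_slobodetskii_space s L2u) (auto simp: unit_cube_eq_box)
  qed
  have nonzero: "nonzero_on ?\<Omega> (u t)" for t
  proof -
    have "u t = (\<lambda>x. t * ?S x + comb (1, t\<^sup>2 * b, t\<^sup>2 * a) x)"
      by (simp add: u_def W_def comb_def fun_eq_iff algebra_simps)
    \<comment> \<open>All perturbations have mean zero, so \<open>u t\<close> has mean 1 and is
      nonzero for every \<open>t\<close>.\<close>
    then have "?i (u t) (comb (1, 0, 0)) = 1"
      by (simp add: L2_inner_add_left L2_inner_scale_left L2 L2_fun_scale L2c inner_S inner_comb)
    then have "(\<integral>x. u t x \<partial>?M) = 1" unfolding one_comb[symmetric] by (simp add: L2_inner_def)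
    then show ?thesis
      unfolding nonzero_on_def using integral_eq_zero_AE[of "u t" ?M] by auto
  qed
  have le: "I t \<le> N t powr (q / 2)" for t
  proof -
    have "(\<lambda>x. 1) = u 0" by (simp add: u_def fun_eq_iff)
    moreover have "I 0 = 1" by (simp add: I_def u_def measure_restrict_space measure_unit_cube)
    ultimately have "energy_quotient ?\<Omega> ev \<phi> s q \<epsilon> (\<lambda>x. 1) = E"
      using energy[of 0] by (simp add: N_def)
    then have le: "E \<le> E * N t / I t powr (2 / q)"
      using minimizer slob[of t] nonzero[of t] unfolding global_minimizer_def energy[symmetric] by metis
    \<comment> \<open>If \<open>I t\<close> were 0, the quotient would have the default value 0 of
      division by zero, contradicting \<open>E > 0\<close>.\<close>
    have "I t \<noteq> 0" using le E0 by auto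
    moreover have "I t \<ge> 0" unfolding I_def by simp
    ultimately have I: "I t > 0" by simp
    then have "E * I t powr (2 / q) \<le> E * N t"
      using le by (simp add: pos_le_divide_eq)
    then have "I t powr (2 / q) \<le> N t" using E0 by (simp only: mult_le_cancel_left_pos)
    then have "(I t powr (2 / q)) powr (q / 2) \<le> N t powr (q / 2)"
      using q2 by (intro powr_mono2) auto
    then show ?thesis using I q2 by (simp add: powr_powr)
  qed
  have "q * (q - 1) / 2 * \<mu> 0 2 + q * (q - 1) * (q - 2) / 2 * \<mu> 2 1 + q * (q - 1) * (q - 2) * (q - 3) / 24 * \<mu> 4 0
     \<le> q / 2 * \<beta> + q / 2 * (q / 2 - 1) / 2 * \<alpha>\<^sup>2"
  proof (rule tendsto_le[OF trivial_limit_at_right_real])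
    show "((\<lambda>t. (N t powr (q / 2) - 1 - q / 2 * \<alpha> * t ^ 2) / t ^ 4) \<longlongrightarrow> q / 2 * \<beta> + q / 2 * (q / 2 - 1) / 2 * \<alpha>\<^sup>2) (at_right 0)"
      unfolding N_def by (rule powr_quartic_expansion)
    show "((\<lambda>t. (I t - 1 - q * (q - 1) / 2 * \<mu> 2 0 * t ^ 2) / t ^ 4) \<longlongrightarrow>
        q * (q - 1) / 2 * \<mu> 0 2 + q * (q - 1) * (q - 2) / 2 * \<mu> 2 1 + q * (q - 1) * (q - 2) * (q - 3) / 24 * \<mu> 4 0) (at_right 0)"
      unfolding I_def u_def \<mu>_def
      by (rule power_integral_expansion) (use \<mu>(1-4) in \<open>auto simp: \<mu>_def intro!: continuous_intros contW\<close>)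
    \<comment> \<open>This is where the threshold enters: both sides have the same coefficient at
      t^2, so after subtraction and division by t^4 the inequality passes to the limit.\<close>
    have "q * (q - 1) / 2 * \<mu> 2 0 = q / 2 * \<alpha>" by (simp add: \<mu> \<alpha>_def)
    then show "\<forall>\<^sub>F t in at_right 0. (I t - 1 - q * (q - 1) / 2 * \<mu> 2 0 * t ^ 2) / t ^ 4
        \<le> (N t powr (q / 2) - 1 - q / 2 * \<alpha> * t ^ 2) / t ^ 4"
      by (simp only:) (intro always_eventually allI divide_right_mono diff_right_mono le, simp)
  qed
  \<comment> \<open>The difference of the two limits is a positive multiple of the expression made
    negative by the choice of \<open>a\<close> and \<open>b\<close>.\<close>
  moreover have "q / 2 * \<beta> + q / 2 * (q / 2 - 1) / 2 * \<alpha>\<^sup>2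
      - (q * (q - 1) / 2 * \<mu> 0 2 + q * (q - 1) * (q - 2) / 2 * \<mu> 2 1 + q * (q - 1) * (q - 2) * (q - 3) / 24 * \<mu> 4 0)
    = q * (q - 2) / 2 * ((4 powr s - 1) * b\<^sup>2 * X + (2 powr s - 1) * a\<^sup>2 * Y - p * (b * X / 2 + a * Y)
      - p * (p - 2) / 12 * (n\<^sup>2 / 4 + X / 4 + Y) + p\<^sup>2 * n\<^sup>2 / 16)"
    unfolding \<mu> \<alpha>_def \<beta>_def p_def by (simp add: field_simps power2_eq_square)
  moreover have "q * (q - 2) / 2 * ((4 powr s - 1) * b\<^sup>2 * X + (2 powr s - 1) * a\<^sup>2 * Y - p * (b * X / 2 + a * Y)
      - p * (p - 2) / 12 * (n\<^sup>2 / 4 + X / 4 + Y) + p\<^sup>2 * n\<^sup>2 / 16) < 0"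
    using ab q2 by (intro mult_pos_neg) auto
  ultimately show False by linarith
qed

end
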